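(* Let $K,L$ be compact, Hausdorff topological spaces such that $L$ is infinite and $K$ is scattered. Then neither $c_0\widehat{\otimes}_\pi C(K)$ nor $C(L)\widehat{\otimes}_\pi C(K)$ is isomorphic to any subspace of any quotient of $C(K)$.
   Context: Topological spaces are non-empty; a space is scattered if every non-empty subset has a (relatively) isolated point. $C(K)$ is the Banach space of continuous scalar-valued (real or complex) functions on $K$ with the sup norm; $\widehat{\otimes}_\pi$ is the (completed) projective tensor product; subspaces are closed. *)

theory Defs
  imports "HOL-Analysis.Analysis"
begin

text \<open>The scalars are a parameter \<open>'s\<close>, to be instantiated with \<open>real\<close> and \<open>complex\<close>.
  Since quotients, tensor products and completions depend on subspaces (terms), spaces are
  structures with an explicit carrier, rather than types of class \<open>real_normed_vector\<close>.\<close>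

record ('s, 'v) nspace =
  vcarrier :: "'v set"
  vzero :: "'v"
  vadd :: "'v \<Rightarrow> 'v \<Rightarrow> 'v"
  vscale :: "'s \<Rightarrow> 'v \<Rightarrow> 'v"
  vnorm :: "'v \<Rightarrow> real"

definition vdiff :: "('s::real_normed_field, 'v) nspace \<Rightarrow> 'v \<Rightarrow> 'v \<Rightarrow> 'v" where
  "vdiff V x y = vadd V x (vscale V (- 1) y)"

definition bounded_linear_on ::
    "('s::real_normed_field, 'v) nspace \<Rightarrow> ('s, 'w) nspace \<Rightarrow> ('v \<Rightarrow> 'w) \<Rightarrow> bool" where
  "bounded_linear_on V W T \<longleftrightarrow>
    (\<forall>x\<in>vcarrier V. T x \<in> vcarrier W) \<and>
    (\<forall>x\<in>vcarrier V. \<forall>y\<in>vcarrier V. T (vadd V x y) = vadd W (T x) (T y)) \<and>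
    (\<forall>c. \<forall>x\<in>vcarrier V. T (vscale V c x) = vscale W c (T x)) \<and>
    (\<exists>B. \<forall>x\<in>vcarrier V. vnorm W (T x) \<le> B * vnorm V x)"

definition isomorphic :: "('s::real_normed_field, 'v) nspace \<Rightarrow> ('s, 'w) nspace \<Rightarrow> bool" where
  "isomorphic V W \<longleftrightarrow>
    (\<exists>T R. bounded_linear_on V W T \<and> bounded_linear_on W V R \<and>
      (\<forall>x\<in>vcarrier V. R (T x) = x) \<and> (\<forall>y\<in>vcarrier W. T (R y) = y))"

definition closed_subspace :: "('s::real_normed_field, 'v) nspace \<Rightarrow> 'v set \<Rightarrow> bool" where
  "closed_subspace V M \<longleftrightarrow>
    M \<subseteq> vcarrier V \<and> vzero V \<in> M \<and>
    (\<forall>x\<in>M. \<forall>y\<in>M. vadd V x y \<in> M) \<and>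
    (\<forall>c. \<forall>x\<in>M. vscale V c x \<in> M) \<and>
    (\<forall>x\<in>vcarrier V. (\<forall>e>0. \<exists>y\<in>M. vnorm V (vdiff V x y) < e) \<longrightarrow> x \<in> M)"

definition coset :: "('s::real_normed_field, 'v) nspace \<Rightarrow> 'v set \<Rightarrow> 'v \<Rightarrow> 'v set" where
  "coset V M x = {vadd V x m | m. m \<in> M}"

text \<open>Adding \<open>M\<close> in the scalar multiple matters for \<open>c = 0\<close> only.\<close>

definition quotient_space ::
    "('s::real_normed_field, 'v) nspace \<Rightarrow> 'v set \<Rightarrow> ('s, 'v set) nspace" where
  "quotient_space V M =
    \<lparr>vcarrier = coset V M ` vcarrier V,
     vzero = M,
     vadd = (\<lambda>A B. {vadd V a b | a b. a \<in> A \<and> b \<in> B}),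
     vscale = (\<lambda>c A. {vadd V (vscale V c a) m | a m. a \<in> A \<and> m \<in> M}),
     vnorm = (\<lambda>A. Inf (vnorm V ` A))\<rparr>"

definition embeds_in_quotient ::
    "('s::real_normed_field, 'v) nspace \<Rightarrow> ('s, 'w) nspace \<Rightarrow> bool" where
  "embeds_in_quotient V W \<longleftrightarrow>
    (\<exists>M S. closed_subspace W M \<and> closed_subspace (quotient_space W M) S \<and>
      isomorphic V ((quotient_space W M)\<lparr>vcarrier := S\<rparr>))"

definition cauchy_seq :: "('s::real_normed_field, 'v) nspace \<Rightarrow> (nat \<Rightarrow> 'v) \<Rightarrow> bool" where
  "cauchy_seq V u \<longleftrightarrow> (\<forall>n. u n \<in> vcarrier V) \<and>
    (\<forall>e>0. \<exists>N. \<forall>m\<ge>N. \<forall>n\<ge>N. vnorm V (vdiff V (u m) (u n)) < e)"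

text \<open>The norm of a class modulo null sequences is the limit of the norms along any of its
  members; the infimum in the quotient norm is thus taken over a single value.\<close>

definition cauchy_space ::
    "('s::real_normed_field, 'v) nspace \<Rightarrow> ('s, nat \<Rightarrow> 'v) nspace" where
  "cauchy_space V =
    \<lparr>vcarrier = {u. cauchy_seq V u},
     vzero = (\<lambda>n. vzero V),
     vadd = (\<lambda>u w n. vadd V (u n) (w n)),
     vscale = (\<lambda>c u n. vscale V c (u n)),
     vnorm = (\<lambda>u. lim (\<lambda>n. vnorm V (u n)))\<rparr>"

definition Banach_completion ::
    "('s::real_normed_field, 'v) nspace \<Rightarrow> ('s, (nat \<Rightarrow> 'v) set) nspace" where
  "Banach_completion V = quotient_space (cauchy_space V)
    {u. cauchy_seq V u \<and> (\<lambda>n. vnorm V (u n)) \<longlonglongrightarrow> 0}"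

text \<open>The algebraic tensor product is the span of the evaluations \<open>x \<otimes> y = (A \<mapsto> A x y)\<close> on the
  space of all bilinear forms. On other arguments (these exist since HOL functions are total) an
  elementary tensor is set to \<open>0\<close>. Every element is a sum of elementary tensors, as the
  scalars can be absorbed into the first factor.\<close>

definition bilinear_form ::
    "('s::real_normed_field, 'v) nspace \<Rightarrow> ('s, 'w) nspace \<Rightarrow> ('v \<Rightarrow> 'w \<Rightarrow> 's) \<Rightarrow> bool" where
  "bilinear_form V W A \<longleftrightarrow>
    (\<forall>x\<in>vcarrier V. \<forall>x'\<in>vcarrier V. \<forall>y\<in>vcarrier W. A (vadd V x x') y = A x y + A x' y) \<and>
    (\<forall>x\<in>vcarrier V. \<forall>y\<in>vcarrier W. \<forall>y'\<in>vcarrier W. A x (vadd W y y') = A x y + A x y') \<and>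
    (\<forall>c. \<forall>x\<in>vcarrier V. \<forall>y\<in>vcarrier W. A (vscale V c x) y = c * A x y) \<and>
    (\<forall>c. \<forall>x\<in>vcarrier V. \<forall>y\<in>vcarrier W. A x (vscale W c y) = c * A x y)"

definition elem_tensor :: "('s::real_normed_field, 'v) nspace \<Rightarrow> ('s, 'w) nspace
    \<Rightarrow> 'v \<Rightarrow> 'w \<Rightarrow> ('v \<Rightarrow> 'w \<Rightarrow> 's) \<Rightarrow> 's" where
  "elem_tensor V W x y A = (if bilinear_form V W A then A x y else 0)"

definition tensor_sum :: "('s::real_normed_field, 'v) nspace \<Rightarrow> ('s, 'w) nspace
    \<Rightarrow> ('v \<times> 'w) list \<Rightarrow> ('v \<Rightarrow> 'w \<Rightarrow> 's) \<Rightarrow> 's" where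
  "tensor_sum V W ps A = (\<Sum>(x, y)\<leftarrow>ps. elem_tensor V W x y A)"

definition algebraic_tensor :: "('s::real_normed_field, 'v) nspace \<Rightarrow> ('s, 'w) nspace
    \<Rightarrow> ('s, ('v \<Rightarrow> 'w \<Rightarrow> 's) \<Rightarrow> 's) nspace" where
  "algebraic_tensor V W =
    \<lparr>vcarrier = {tensor_sum V W ps | ps. set ps \<subseteq> vcarrier V \<times> vcarrier W},
     vzero = (\<lambda>A. 0),
     vadd = (\<lambda>u v A. u A + v A),
     vscale = (\<lambda>c u A. c * u A),
     vnorm = (\<lambda>u. Inf {\<Sum>(x, y)\<leftarrow>ps. vnorm V x * vnorm W y | ps.
       set ps \<subseteq> vcarrier V \<times> vcarrier W \<and> u = tensor_sum V W ps})\<rparr>"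

definition projective_tensor :: "('s::real_normed_field, 'v) nspace \<Rightarrow> ('s, 'w) nspace
    \<Rightarrow> ('s, (nat \<Rightarrow> ('v \<Rightarrow> 'w \<Rightarrow> 's) \<Rightarrow> 's) set) nspace"
    (infixr \<open>\<otimes>\<^sub>\<pi>\<close> 70) where
  "V \<otimes>\<^sub>\<pi> W = Banach_completion (algebraic_tensor V W)"

definition scale_bcontfun ::
    "'s::real_normed_field \<Rightarrow> ('k::topological_space \<Rightarrow>\<^sub>C 's) \<Rightarrow> ('k \<Rightarrow>\<^sub>C 's)" where
  "scale_bcontfun c f = Bcontfun (\<lambda>x. c * apply_bcontfun f x)"

lemma apply_scale_bcontfun [simp]:
  "apply_bcontfun (scale_bcontfun c f) x = c * apply_bcontfun f x"
proof -
  have "norm (c * apply_bcontfun f x) \<le> norm c * norm f" for x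
    by (simp add: norm_mult mult_left_mono norm_bounded)
  then have "(\<lambda>x. c * apply_bcontfun f x) \<in> bcontfun"
    by (intro bcontfun_normI continuous_intros) auto
  then show ?thesis by (simp add: scale_bcontfun_def Bcontfun_inverse)
qed

text \<open>On a compact \<open>'k\<close>, every continuous function is bounded, so that the type
  \<open>'k \<Rightarrow>\<^sub>C 's\<close> with its supremum norm is the space \<open>C(K)\<close> for \<open>K = UNIV\<close>. The arguments only
  display the space and the scalar field.\<close>

definition C_space :: "'k::topological_space itself \<Rightarrow> 's::real_normed_field itself
    \<Rightarrow> ('s, 'k \<Rightarrow>\<^sub>C 's) nspace" where
  "C_space _ _ =
    \<lparr>vcarrier = UNIV,
     vzero = 0,
     vadd = (+),
     vscale = scale_bcontfun,
     vnorm = norm\<rparr>"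

text \<open>As \<open>nat\<close> is discrete, \<open>nat \<Rightarrow>\<^sub>C 's\<close> is the space of all bounded sequences.\<close>

definition c0_space :: "'s::real_normed_field itself \<Rightarrow> ('s, nat \<Rightarrow>\<^sub>C 's) nspace" where
  "c0_space S = (C_space TYPE(nat) S)\<lparr>vcarrier := {f. apply_bcontfun f \<longlonglongrightarrow> 0}\<rparr>"

definition scattered :: "'a::topological_space set \<Rightarrow> bool" where
  "scattered X \<longleftrightarrow> (\<forall>S\<subseteq>X. S \<noteq> {} \<longrightarrow> (\<exists>x. x isolated_in S))"

end

theory Submission
  imports Defs
begin

text \<open>
  Choose \<open>\<xi>\<close> with \<open>K\<^bsup>(\<omega>\<^sup>\<xi>)\<^esup> \<noteq> \<emptyset>\<close> and \<open>K\<^bsup>(\<omega>\<^sup>\<xi> m)\<^esup> = \<emptyset>\<close> for some \<open>m\<close>. For operators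
  \<open>T\<^sub>1, \<dots>, T\<^sub>n\<close> from \<open>C(K)\<close> to a quotient of \<open>C(K)\<close> with norms at most \<open>B\<close>, one finds functions
  \<open>f\<^sub>i\<close> and points \<open>x\<^sub>i\<close> with \<open>f\<^sub>i(x\<^sub>i) = 1\<close> such that \<open>T\<^sub>1 f\<^sub>1 + \<dots> + T\<^sub>n f\<^sub>n\<close> has a norm that is bounded
  independently of \<open>n\<close>: each \<open>f\<^sub>i\<close> is chosen so that a lift of \<open>T\<^sub>i f\<^sub>i\<close> is small on
  \<open>K\<^bsup>(\<omega>\<^sup>\<xi> k)\<^esup>\<close> off a neighbourhood of \<open>K\<^bsup>(\<omega>\<^sup>\<xi> (k+1))\<^esup>\<close>, for all \<open>k < m\<close>, which lets at most \<open>m\<close> of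
  the lifts be large at the same point. That such a choice is possible is shown by induction on
  \<open>\<xi>\<close>: for \<open>\<xi> = 0\<close> by the pigeonhole principle on a finite set, and for \<open>\<xi> + 1\<close> by averaging many
  functions obtained for \<open>\<xi>\<close>.

  On the other hand, let \<open>v\<^sub>1, \<dots>, v\<^sub>n\<close> be elements of the unit ball of \<open>c\<^sub>0\<close> or \<open>C(L)\<close> that restrict
  to the Rademacher functions on a set of \<open>2\<^sup>n\<close> points. Testing with the bilinear form
  \<open>(v, f) \<mapsto> 2\<^sup>-\<^sup>n \<Sum>\<^sub>S \<Sum>\<^sub>i v(S) r\<^sub>i(S) f(x\<^sub>i)\<close>, which has norm at most \<open>\<surd>n\<close>, shows that
  \<open>v\<^sub>1 \<otimes> f\<^sub>1 + \<dots> + v\<^sub>n \<otimes> f\<^sub>n\<close> has projective norm at least \<open>\<surd>n\<close>. So the operators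
  \<open>T\<^sub>i f = T (v\<^sub>i \<otimes> f)\<close> cannot come from an embedding \<open>T\<close>. If \<open>K\<close> is finite, then \<open>C(K)\<close> is
  finite-dimensional and the projective tensor product is not.
\<close>

section \<open>Derivatives of order a power of omega\<close>

definition derived :: "'a::topological_space set \<Rightarrow> 'a set" where
  "derived A = {x \<in> A. x islimpt A}"

text \<open>The members of \<open>power_op\<close> are the maps \<open>A \<mapsto> A\<^bsup>(\<omega>\<^sup>\<xi>)\<^esup>\<close> taking a set to its Cantor--Bendixson
  derivative of order \<open>\<omega>\<^sup>\<xi>\<close>: multiplying the order by \<open>\<omega>\<close> intersects all finite iterates, and
  a limit \<open>\<xi>\<close> intersects a chain. Representing these ordinals by operators avoids ordinal arithmetic.\<close>

inductive power_op :: "('a::topological_space set \<Rightarrow> 'a set) \<Rightarrow> bool" where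
  derived: "power_op derived"
| omega: "power_op F \<Longrightarrow> power_op (INF n. F ^^ n)"
| chain: "power_op (Inf \<F>)"
    if "\<F> \<noteq> {}" "\<And>F. F \<in> \<F> \<Longrightarrow> power_op F" "\<And>F G. F \<in> \<F> \<Longrightarrow> G \<in> \<F> \<Longrightarrow> F \<le> G \<or> G \<le> F"

text \<open>The properties of Cantor--Bendixson derivatives that survive iteration and intersection
  of chains. The last clause is restricted to closed sets, where a limit point of \<open>A\<close>
  also lies in \<open>A\<close>.\<close>

definition derivation :: "('a::topological_space set \<Rightarrow> 'a set) \<Rightarrow> bool" where
  "derivation F \<longleftrightarrow> mono F \<and> F \<le> derived \<and> (\<forall>A. closed A \<longrightarrow> closed (F A)) \<and>
    (\<forall>A B. closed A \<longrightarrow> closed B \<longrightarrow> F (A \<union> B) \<subseteq> F A \<union> F B)"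

lemma derivationD:
  assumes "derivation F"
  shows "A \<subseteq> B \<Longrightarrow> F A \<subseteq> F B" "F A \<subseteq> derived A" "F A \<subseteq> A" "closed A \<Longrightarrow> closed (F A)"
    "closed A \<Longrightarrow> closed B \<Longrightarrow> F (A \<union> B) \<subseteq> F A \<union> F B"
  using assms by (auto simp: derivation_def derived_def le_fun_def mono_def)

lemma derivation_derived: "derivation (derived :: 'a::topological_space set \<Rightarrow> 'a set)"
proof -
  have "closed (derived A)" if cl: "closed A" for A :: "'a set"
  proof -
    have "\<exists>T. open T \<and> x \<in> T \<and> T \<subseteq> - derived A" if x: "x \<notin> derived A" for x
    proof (cases "x \<in> A")
      case True
      then obtain T where "open T" "x \<in> T" "\<forall>y\<in>A. y \<in> T \<longrightarrow> y = x"
        using x by (auto simp: derived_def islimpt_def)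
      moreover have "T \<inter> derived A \<subseteq> {x}"
        using calculation by (auto simp: derived_def)
      then have "T \<subseteq> - derived A" using x by blast
      ultimately show ?thesis by blast
    next
      case False
      moreover have "- A \<subseteq> - derived A" by (auto simp: derived_def)
      ultimately show ?thesis using open_Compl[OF cl] by blast
    qed
    then show ?thesis unfolding closed_def by (subst open_subopen) auto
  qed
  moreover have "derived (A \<union> B) \<subseteq> derived A \<union> derived B" if "closed A" "closed B" for A B :: "'a set"
  proof
    fix x assume "x \<in> derived (A \<union> B)"
    then have "x islimpt A \<or> x islimpt B" by (simp add: derived_def islimpt_Un)
    then show "x \<in> derived A \<union> derived B"
      using that by (metis (no_types, lifting) UnI1 UnI2 closed_limpt derived_def mem_Collect_eq)
  qed
  moreover have "mono (derived :: 'a set \<Rightarrow> 'a set)"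
    by (rule monoI) (auto simp: derived_def intro: islimpt_subset)
  ultimately show ?thesis unfolding derivation_def by blast
qed

lemma derivation_funpow:
  assumes "derivation F"
  shows "closed A \<Longrightarrow> closed ((F ^^ n) A)"
    and "mono (F ^^ n)"
    and "closed A \<Longrightarrow> closed B \<Longrightarrow> (F ^^ n) (A \<union> B) \<subseteq> (F ^^ n) A \<union> (F ^^ n) B"
    and "antimono (\<lambda>n. (F ^^ n) A)"
proof -
  show cl: "closed A \<Longrightarrow> closed ((F ^^ n) A)" for A n
    by (induction n) (auto intro: derivationD[OF assms])
  have "mono F" using assms by (simp add: derivation_def)
  then show "mono (F ^^ n)" by (rule mono_pow)
  show "(F ^^ n) (A \<union> B) \<subseteq> (F ^^ n) A \<union> (F ^^ n) B" if "closed A" "closed B"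
  proof (induction n)
    case (Suc n)
    have "F ((F ^^ n) (A \<union> B)) \<subseteq> F ((F ^^ n) A \<union> (F ^^ n) B)"
      by (rule derivationD(1)[OF assms Suc])
    also have "\<dots> \<subseteq> F ((F ^^ n) A) \<union> F ((F ^^ n) B)"
      by (rule derivationD(5)[OF assms cl[OF that(1)] cl[OF that(2)]])
    finally show ?case by simp
  qed simp
  show "antimono (\<lambda>n. (F ^^ n) A)"
    unfolding antimono_iff_le_Suc using derivationD(3)[OF assms] by simp
qed

text \<open>Only finitely many levels \<open>k\<close> carry points. This keeps the bounds
  \<open>2 * B * (real m - real k)\<close> nonnegative wherever they are claimed.\<close>

lemma funpow_empty_less:
  assumes "derivation F" "(F ^^ m) A = {}" "x \<in> (F ^^ k) A"
  shows "k < m"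
proof (rule ccontr)
  assume "\<not> k < m"
  then have "(F ^^ k) A \<subseteq> (F ^^ m) A"
    by (intro antimonoD[OF derivation_funpow(4)[OF assms(1)]]) simp
  then show False using assms(2,3) by blast
qed

text \<open>For the union clause: a point outside \<open>(F ^^ i) A\<close> and
  \<open>(F ^^ j) B\<close> lies outside the iterates of order \<open>max i j\<close> of both sets,
  as iterates decrease, so the clause for a single iterate applies.\<close>

lemma derivation_omega:
  assumes "derivation F"
  shows "derivation (INF n. F ^^ n)"
  unfolding derivation_def
proof (intro conjI allI impI)
  show "mono (INF n. F ^^ n)"
    using derivation_funpow(2)[OF assms] unfolding mono_def INF_apply by (meson INF_mono')
  have "(INF n. F ^^ n) \<le> F ^^ 1" by (rule INF_lower) simp
  also have "\<dots> \<le> derived" using assms by (simp add: derivation_def)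
  finally show "(INF n. F ^^ n) \<le> derived" .
  show "closed ((INF n. F ^^ n) A)" if "closed A" for A
    using derivation_funpow(1)[OF assms that] by auto
  show "(INF n. F ^^ n) (A \<union> B) \<subseteq> (INF n. F ^^ n) A \<union> (INF n. F ^^ n) B" if cl: "closed A" "closed B" for A B
  proof
    fix x assume x: "x \<in> (INF n. F ^^ n) (A \<union> B)"
    show "x \<in> (INF n. F ^^ n) A \<union> (INF n. F ^^ n) B"
    proof (rule ccontr)
      assume "\<not> ?thesis"
      then obtain i j where "x \<notin> (F ^^ i) A" "x \<notin> (F ^^ j) B" by auto
      moreover have "(F ^^ max i j) A \<subseteq> (F ^^ i) A" "(F ^^ max i j) B \<subseteq> (F ^^ j) B"
        using derivation_funpow(4)[OF assms] by (simp_all add: antimono_def)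
      moreover have "x \<in> (F ^^ max i j) (A \<union> B)" using x by auto
      ultimately show False using derivation_funpow(3)[OF assms cl, of "max i j"] by blast
    qed
  qed
qed

text \<open>The union clause holds as in the case of iterates: of two members of the chain, the
  smaller one excludes the point from both sets.\<close>

lemma derivation_chain:
  assumes "\<F> \<noteq> {}" "\<And>F. F \<in> \<F> \<Longrightarrow> derivation F"
    and chain: "\<And>F G. F \<in> \<F> \<Longrightarrow> G \<in> \<F> \<Longrightarrow> F \<le> G \<or> G \<le> F"
  shows "derivation (Inf \<F>)"
  unfolding derivation_def
proof (intro conjI allI impI)
  show "mono (Inf \<F>)"
    using derivationD(1)[OF assms(2)] unfolding mono_def Inf_apply by (meson INF_mono)
  obtain F where "F \<in> \<F>" using assms(1) by blast
  then show "Inf \<F> \<le> derived"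
    using assms(2)[of F] by (auto simp: derivation_def intro: Inf_lower2)
  show "closed (Inf \<F> A)" if "closed A" for A
    using derivationD(4)[OF assms(2) that] by auto
  show "Inf \<F> (A \<union> B) \<subseteq> Inf \<F> A \<union> Inf \<F> B" if cl: "closed A" "closed B" for A B
  proof
    fix x assume x: "x \<in> Inf \<F> (A \<union> B)"
    show "x \<in> Inf \<F> A \<union> Inf \<F> B"
    proof (rule ccontr)
      assume "\<not> ?thesis"
      then obtain F G where FG: "F \<in> \<F>" "G \<in> \<F>" "x \<notin> F A" "x \<notin> G B" by auto
      obtain E where "E \<in> \<F>" "E \<le> F" "E \<le> G" using chain[OF FG(1,2)] FG(1,2) by blast
      moreover from this have "x \<in> E (A \<union> B)" using x by auto
      ultimately show False
        using derivationD(5)[OF assms(2) cl, of E] FG(3,4) unfolding le_fun_def by blast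
    qed
  qed
qed

lemma power_op_derivation: "power_op F \<Longrightarrow> derivation F"
proof (induction rule: power_op.induct)
  case (chain \<F>)
  then show ?case by (intro derivation_chain)
qed (intro derivation_derived derivation_omega)+

text \<open>By the finite intersection property some finite subfamily has empty intersection, and
  the intersection of a finite chain is one of its members.\<close>

lemma compact_chain_Inter_empty:
  fixes \<A> :: "'a::t2_space set set"
  assumes "\<And>A. A \<in> \<A> \<Longrightarrow> compact A" "\<A> \<noteq> {}" "\<Inter>\<A> = {}"
    and chain: "\<And>A B. A \<in> \<A> \<Longrightarrow> B \<in> \<A> \<Longrightarrow> A \<subseteq> B \<or> B \<subseteq> A"
  shows "{} \<in> \<A>"
proof -
  obtain A where A: "A \<in> \<A>" using assms(2) by blast
  have "\<exists>\<B>\<subseteq>\<A>. finite \<B> \<and> A \<inter> \<Inter>\<B> = {}"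
    using compact_imp_fip[of A \<A>] assms A by (metis Int_empty_right compact_imp_closed)
  then obtain \<B> where B: "\<B> \<subseteq> \<A>" "finite \<B>" "A \<inter> \<Inter>\<B> = {}" by blast
  have "subset.chain \<A> (insert A \<B>)"
    unfolding subset_chain_def using B(1) A chain by (meson insert_subset subset_iff)
  then have "\<Inter>(insert A \<B>) \<in> insert A \<B>"
    using B(2) by (intro Inter_in_chain) auto
  then show ?thesis using A B by auto
qed

text \<open>The iterates of a compact set form a decreasing sequence of compact sets, so an empty
  intersection is reached after finitely many steps.\<close>

lemma derivation_omega_empty:
  fixes F :: "'a::t2_space set \<Rightarrow> 'a set"
  assumes "derivation F" "compact A" "(INF n. F ^^ n) A = {}"
  shows "\<exists>m. (F ^^ m) A = {}"
proof -
  have "{} \<in> range (\<lambda>n. (F ^^ n) A)"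
  proof (rule compact_chain_Inter_empty)
    show "compact B" if B: "B \<in> range (\<lambda>n. (F ^^ n) A)" for B
    proof -
      obtain n where n: "B = (F ^^ n) A" using B by blast
      have "closed B" "B \<subseteq> A"
        using derivation_funpow(1)[OF assms(1)] antimonoD[OF derivation_funpow(4)[OF assms(1), of A], of 0 n]
          assms(2) n by (simp_all add: compact_imp_closed)
      then show ?thesis using assms(2) by (metis closed_Int_compact inf.absorb1)
    qed
    show "B \<subseteq> C \<or> C \<subseteq> B" if BC: "B \<in> range (\<lambda>n. (F ^^ n) A)" "C \<in> range (\<lambda>n. (F ^^ n) A)" for B C
    proof -
      obtain m where "B = (F ^^ m) A" using BC(1) by blast
      moreover obtain n where "C = (F ^^ n) A" using BC(2) by blast
      ultimately show ?thesis
        using antimonoD[OF derivation_funpow(4)[OF assms(1), of A]] linear[of m n] by blast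
    qed
  qed (use assms(3) in auto)
  then show ?thesis by (metis rangeE)
qed

lemma derivation_chain_empty:
  fixes \<F> :: "('a::t2_space set \<Rightarrow> 'a set) set"
  assumes "\<F> \<noteq> {}" "\<And>F. F \<in> \<F> \<Longrightarrow> derivation F"
    and chain: "\<And>F G. F \<in> \<F> \<Longrightarrow> G \<in> \<F> \<Longrightarrow> F \<le> G \<or> G \<le> F"
    and "compact A" "Inf \<F> A = {}"
  shows "\<exists>F\<in>\<F>. F A = {}"
proof -
  have "{} \<in> (\<lambda>F. F A) ` \<F>"
  proof (rule compact_chain_Inter_empty)
    show "compact B" if "B \<in> (\<lambda>F. F A) ` \<F>" for B
    proof -
      have "closed B" "B \<subseteq> A"
        using that derivationD(3,4)[OF assms(2)] assms(4) by (auto simp: compact_imp_closed)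
      then show ?thesis using assms(4) by (metis closed_Int_compact inf.absorb1)
    qed
    show "B \<subseteq> C \<or> C \<subseteq> B" if "B \<in> (\<lambda>F. F A) ` \<F>" "C \<in> (\<lambda>F. F A) ` \<F>" for B C
      using that chain unfolding le_fun_def by blast
  qed (use assms(1,5) in auto)
  then show ?thesis by auto
qed

text \<open>The infimum \<open>G\<close> of a maximal chain satisfies \<open>G \<le> G \<circ> G\<close>, so that \<open>G UNIV\<close> has no isolated point.\<close>

lemma scattered_power_op_empty:
  assumes "scattered (UNIV :: 'a::t2_space set)"
  shows "\<exists>F. power_op F \<and> F (UNIV :: 'a set) = {}"
proof -
  let ?P = "{F :: 'a set \<Rightarrow> 'a set. power_op F}"
  obtain \<C> where "pred_on.maxchain ?P (<) \<C>"
    using pred_on.Hausdorff by blast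
  then have chain: "pred_on.chain ?P (<) \<C>"
    and max: "\<And>\<D>. pred_on.chain ?P (<) \<D> \<Longrightarrow> \<not> \<C> \<subset> \<D>"
    unfolding pred_on.maxchain_def by blast+
  have C: "\<C> \<subseteq> ?P" "\<And>F G. F \<in> \<C> \<Longrightarrow> G \<in> \<C> \<Longrightarrow> F \<le> G \<or> G \<le> F"
    using chain unfolding pred_on.chain_def le_less by blast+
  have ne: "\<C> \<noteq> {}"
    using max[of "{derived}"] power_op.derived by (auto simp: pred_on.chain_def)
  define G where "G = Inf \<C>"
  define G' where "G' = (INF n. G ^^ n)"
  have G: "power_op G" unfolding G_def
    by (rule power_op.chain) (use C ne in auto)
  then have G': "power_op G'" unfolding G'_def by (rule power_op.omega)
  have "G' \<le> G ^^ 1" unfolding G'_def by (rule INF_lower) simp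
  then have le: "G' \<le> F" if "F \<in> \<C>" for F
    using Inf_lower[OF that] by (auto simp: G_def intro: order_trans)
  \<comment> \<open>\<open>G'\<close> lies below every member of \<open>\<C>\<close>, so adding it
    leaves a chain. Maximality forces \<open>G'\<close> into \<open>\<C>\<close>, hence above the
    infimum \<open>G\<close>.\<close>
  have "pred_on.chain ?P (<) (insert G' \<C>)"
    unfolding pred_on.chain_def using C G' le unfolding le_less by blast
  then have "G' \<in> \<C>" using max by blast
  then have "G \<le> G'" unfolding G_def by (rule Inf_lower)
  also have "G' \<le> G ^^ 2" unfolding G'_def by (rule INF_lower) simp
  finally have "G UNIV \<subseteq> G (G UNIV)" by (simp add: le_fun_def numeral_2_eq_2)
  also have "\<dots> \<subseteq> derived (G UNIV)"
    by (rule derivationD(2)[OF power_op_derivation[OF G]])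
  finally have "\<not> x isolated_in G UNIV" for x
    by (auto simp: derived_def isolated_in_islimpt_iff)
  then have "G UNIV = {}" using assms by (auto simp: scattered_def)
  then show ?thesis using G by blast
qed

text \<open>The first power of omega whose derivative is empty is not 1, since an infinite compact
  space has a limit point, and by compactness its exponent is not a limit. So it is omega times the
  preceding power, finitely many iterates of which suffice. The induction on \<open>power_op\<close>
  expresses this without a least element.\<close>

lemma scattered_power_op_height:
  assumes "compact (UNIV :: 'a::t2_space set)" "scattered (UNIV :: 'a set)" "infinite (UNIV :: 'a set)"
  obtains F m where "power_op F" "F (UNIV :: 'a set) \<noteq> {}" "(F ^^ m) (UNIV :: 'a set) = {}"
proof -
  have "\<exists>G m. power_op G \<and> G (UNIV :: 'a set) \<noteq> {} \<and> (G ^^ m) (UNIV :: 'a set) = {}"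
    if "power_op F" "F (UNIV :: 'a set) = {}" for F
    using that
  proof (induction rule: power_op.induct)
    case derived
    obtain x :: 'a where "x islimpt UNIV"
      using Heine_Borel_imp_Bolzano_Weierstrass[OF assms(1,3)] by auto
    then show ?case using derived by (auto simp: derived_def)
  next
    case (omega F)
    show ?case
    proof (cases "F (UNIV :: 'a set) = {}")
      case False
      then show ?thesis
        using omega derivation_omega_empty[OF power_op_derivation assms(1)] by blast
    qed (use omega in blast)
  next
    case (chain \<F>)
    then show ?case
      using derivation_chain_empty[OF _ power_op_derivation _ assms(1), of \<F>] by blast
  qed
  then show thesis using scattered_power_op_empty[OF assms(2)] that by blast
qed

section \<open>Bounded sums of lifts\<close>

text \<open>\<open>R f g\<close> stands for \<open>T f = g + M\<close> with a bounded operator \<open>T\<close> into a quotient by \<open>M\<close>.\<close>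

definition liftable :: "real \<Rightarrow> ('v::real_normed_vector \<Rightarrow> 'w::real_normed_vector \<Rightarrow> bool) \<Rightarrow> bool" where
  "liftable B R \<longleftrightarrow>
    (\<forall>f g f' g'. R f g \<longrightarrow> R f' g' \<longrightarrow> R (f + f') (g + g')) \<and>
    (\<forall>c f g. R f g \<longrightarrow> R (c *\<^sub>R f) (c *\<^sub>R g)) \<and>
    (\<forall>f. norm f \<le> 1 \<longrightarrow> (\<exists>g. R f g \<and> norm g \<le> B))"

lemma liftableD:
  assumes "liftable B R"
  shows "R f g \<Longrightarrow> R f' g' \<Longrightarrow> R (f + f') (g + g')"
    and "R f g \<Longrightarrow> R (c *\<^sub>R f) (c *\<^sub>R g)"
    and "R f g \<Longrightarrow> R f' g' \<Longrightarrow> R (f - f') (g - g')"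
    and "norm f \<le> 1 \<Longrightarrow> \<exists>g. R f g \<and> norm g \<le> B"
    and "R 0 0"
    and "0 \<le> B"
proof -
  show add: "R f g \<Longrightarrow> R f' g' \<Longrightarrow> R (f + f') (g + g')" for f g f' g'
    using assms by (simp add: liftable_def)
  show scale: "R f g \<Longrightarrow> R (c *\<^sub>R f) (c *\<^sub>R g)" for c f g
    using assms by (simp add: liftable_def)
  show lift: "norm f \<le> 1 \<Longrightarrow> \<exists>g. R f g \<and> norm g \<le> B" for f
    using assms by (simp add: liftable_def)
  show "R f g \<Longrightarrow> R f' g' \<Longrightarrow> R (f - f') (g - g')"
    using add[of f g "- f'" "- g'"] scale[of f' g' "- 1"] by simp
  obtain g where g: "R 0 g" "norm g \<le> B" using lift[of 0] by auto
  show "R 0 0" using scale[OF g(1), of 0] by simp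
  show "0 \<le> B" using g(2) norm_ge_zero order_trans by blast
qed

section \<open>Separating functions and a pigeonhole principle\<close>

lemma compact_Urysohn:
  fixes S T :: "'a::t2_space set"
  assumes "compact (UNIV :: 'a set)" "closed S" "closed T" "S \<inter> T = {}"
  obtains u :: "'a \<Rightarrow> real" where "continuous_on UNIV u" "\<And>x. 0 \<le> u x" "\<And>x. u x \<le> 1"
    "\<And>x. x \<in> S \<Longrightarrow> u x = 0" "\<And>x. x \<in> T \<Longrightarrow> u x = 1"
proof -
  have "Hausdorff_space (euclidean :: 'a topology)"
    unfolding Hausdorff_space_def using hausdorff by (auto simp: disjnt_def)
  then have "normal_space (euclidean :: 'a topology)"
    using assms(1) by (intro compact_Hausdorff_or_regular_imp_normal_space) (auto simp: compact_space_def)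
  then obtain u where "continuous_map (euclidean :: 'a topology) (top_of_set {0..1::real}) u"
      "u ` S \<subseteq> {0}" "u ` T \<subseteq> {1}"
    using Urysohn_lemma[of euclidean S T 0 1] assms by (auto simp: disjnt_def)
  then show thesis
    by (intro that[of u]) (auto simp: continuous_map_in_subtopology image_subset_iff)
qed

lemma bcontfun_of_real:
  fixes u :: "'a::topological_space \<Rightarrow> real"
  assumes "continuous_on UNIV u" "\<And>x. \<bar>u x\<bar> \<le> 1"
  obtains h :: "'a \<Rightarrow>\<^sub>C 's::real_normed_algebra_1" where "\<And>x. h x = of_real (u x)" "norm h \<le> 1"
proof -
  have "(\<lambda>x. of_real (u x) :: 's) \<in> bcontfun"
    using assms by (intro bcontfun_normI[of _ 1] continuous_intros) auto
  then have *: "apply_bcontfun (Bcontfun (\<lambda>x. of_real (u x) :: 's)) x = of_real (u x)" for x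
    by (simp add: Bcontfun_inverse)
  show thesis
    by (rule that[OF *], rule norm_bound) (simp add: * assms(2))
qed

lemma bump_function:
  fixes p z :: "'a::t2_space"
  assumes "compact (UNIV :: 'a set)" "p \<noteq> z"
  obtains h :: "'a \<Rightarrow>\<^sub>C 's::real_normed_algebra_1" and U V where "norm h \<le> 1"
    "open U" "p \<in> U" "\<And>x. x \<in> U \<Longrightarrow> h x = 0" "open V" "z \<in> V" "\<And>x. x \<in> V \<Longrightarrow> h x = 1"
proof -
  obtain u :: "'a \<Rightarrow> real" where u: "continuous_on UNIV u" "u p = 0" "u z = 1"
    using compact_Urysohn[OF assms(1) closed_singleton closed_singleton, of p z] assms(2)
    by (metis Int_insert_right_if0 Int_empty_right singletonD singletonI)
  \<comment> \<open>Cutting off \<open>3 * u x - 1\<close> makes the function constant on whole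
    neighbourhoods: 0 where \<open>u\<close> is below 1/3 and 1 where \<open>u\<close> exceeds
    2/3.\<close>
  define v where "v x = max 0 (min 1 (3 * u x - 1))" for x
  have "continuous_on UNIV v" unfolding v_def by (intro continuous_intros u(1))
  then obtain h :: "'a \<Rightarrow>\<^sub>C 's" where h: "\<And>x. h x = of_real (v x)" "norm h \<le> 1"
    using bcontfun_of_real[of v thesis] by (simp add: v_def) blast
  have "open {x. u x < 1 / 3}" "open {x. 2 / 3 < u x}"
    by (intro open_Collect_less continuous_intros u(1))+
  then show thesis
    using u h by (intro that[of h "{x. u x < 1 / 3}" "{x. 2 / 3 < u x}"]) (auto simp: v_def)
qed

lemma finite_convergent_subsequence:
  fixes u :: "nat \<Rightarrow> 'a \<Rightarrow> 'b::heine_borel"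
  assumes "finite A" "\<And>a. a \<in> A \<Longrightarrow> bounded (range (\<lambda>n. u n a))"
  shows "\<exists>r. strict_mono (r :: nat \<Rightarrow> nat) \<and> (\<forall>a\<in>A. convergent (\<lambda>n. u (r n) a))"
  using assms
proof (induction A)
  case empty
  show ?case by (intro exI[of _ id]) (simp add: strict_mono_def)
next
  case (insert a A)
  then obtain r :: "nat \<Rightarrow> nat" where r: "strict_mono r" "\<And>b. b \<in> A \<Longrightarrow> convergent (\<lambda>n. u (r n) b)"
    by auto
  have "bounded (range (\<lambda>n. u (r n) a))"
    by (rule bounded_subset[OF insert.prems[of a]]) auto
  then obtain l q where q: "strict_mono (q :: nat \<Rightarrow> nat)" "((\<lambda>n. u (r n) a) \<circ> q) \<longlonglongrightarrow> l"
    using bounded_imp_convergent_subsequence by blast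
  have "convergent (\<lambda>n. u ((r \<circ> q) n) b)" if "b \<in> insert a A" for b
  proof (cases "b = a")
    case True
    then show ?thesis using q(2) by (auto simp: convergent_def o_def)
  next
    case False
    then show ?thesis
      using convergent_subseq_convergent[OF r(2) q(1), of b] that by (simp add: o_def)
  qed
  then show ?case using strict_mono_o[OF r(1) q(1)] by blast
qed

text \<open>Some subsequence converges at every point of the finite set \<open>A\<close>, and two
  late consecutive terms of it are close at all these points.\<close>

lemma finite_pigeonhole:
  fixes u :: "nat \<Rightarrow> 'a \<Rightarrow> 'b::heine_borel"
  assumes "finite A" "\<And>a. a \<in> A \<Longrightarrow> bounded (range (\<lambda>n. u n a))" "0 < e"
  obtains i j where "i < j" "\<And>a. a \<in> A \<Longrightarrow> dist (u i a) (u j a) < e"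
proof -
  obtain r :: "nat \<Rightarrow> nat" where r: "strict_mono r" "\<forall>a\<in>A. convergent (\<lambda>n. u (r n) a)"
    using finite_convergent_subsequence[of A u] assms(1,2) by blast
  then obtain l where "\<forall>a\<in>A. (\<lambda>n. u (r n) a) \<longlonglongrightarrow> l a"
    unfolding convergent_def by metis
  then have "\<forall>a\<in>A. \<forall>\<^sub>F n in sequentially. dist (u (r n) a) (l a) < e / 2"
    using tendstoD[OF _ half_gt_zero[OF assms(3)]] by blast
  then have "\<forall>\<^sub>F n in sequentially. \<forall>a\<in>A. dist (u (r n) a) (l a) < e / 2"
    using assms(1) by (simp add: eventually_ball_finite)
  then obtain N where "\<And>n a. n \<ge> N \<Longrightarrow> a \<in> A \<Longrightarrow> dist (u (r n) a) (l a) < e / 2"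
    unfolding eventually_sequentially by blast
  then have "dist (u (r N) a) (u (r (Suc N)) a) < e" if "a \<in> A" for a
    using that dist_triangle_half_l[of "u (r N) a" "l a" e "u (r (Suc N)) a"] by simp
  then show thesis using r(1) by (intro that[of "r N" "r (Suc N)"]) (auto simp: strict_mono_def)
qed

text \<open>Here \<open>Z\<close> is meant to be a derivative of the space. That \<open>f\<close> is \<open>1\<close> near a point of \<open>Z\<close> inside \<open>H\<close>
  allows the choice of a further \<open>f\<close> below it, so that sums of such functions still attain their
  maximal possible value.\<close>

definition dominates :: "'s::real_normed_field itself \<Rightarrow> ('k::topological_space set \<Rightarrow> 'k set) \<Rightarrow> bool" where
  "dominates _ F \<longleftrightarrow>
    (\<forall>A B (R :: ('k \<Rightarrow>\<^sub>C 's) \<Rightarrow> ('k \<Rightarrow>\<^sub>C 's) \<Rightarrow> bool) e Z p H.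
      closed A \<longrightarrow> F A = {} \<longrightarrow> liftable B R \<longrightarrow> 0 < e \<longrightarrow> closed Z \<longrightarrow> p \<in> F Z \<longrightarrow> open H \<longrightarrow> p \<in> H \<longrightarrow>
      (\<exists>f g V. R f g \<and> norm g \<le> 2 * B \<and> (\<forall>x\<in>A. norm (apply_bcontfun g x) \<le> e) \<and>
        open V \<and> V \<subseteq> H \<and> V \<inter> Z \<noteq> {} \<and> (\<forall>x\<in>V. apply_bcontfun f x = 1)))"

lemma dominatesD:
  fixes R :: "('k::topological_space \<Rightarrow>\<^sub>C 's::real_normed_field) \<Rightarrow> ('k \<Rightarrow>\<^sub>C 's) \<Rightarrow> bool"
  assumes "dominates TYPE('s) F" "closed A" "F A = {}" "liftable B R" "0 < e" "closed Z" "p \<in> F Z" "open H" "p \<in> H"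
  obtains f g V where "R f g" "norm g \<le> 2 * B" "\<And>x. x \<in> A \<Longrightarrow> norm (apply_bcontfun g x) \<le> e"
    "open V" "V \<subseteq> H" "V \<inter> Z \<noteq> {}" "\<And>x. x \<in> V \<Longrightarrow> apply_bcontfun f x = 1"
  using assms(1)[unfolded dominates_def, THEN spec[of _ A], THEN spec[of _ B], THEN spec[of _ R],
    THEN spec[of _ e], THEN spec[of _ Z], THEN spec[of _ p], THEN spec[of _ H]] assms(2-9) that
  by blast

text \<open>A closed subset of a compact space without limit points of its own is finite. Among
  infinitely many lifts of norm at most \<open>B\<close>, two nearly agree on it; the difference of
  the corresponding functions is the required one, provided that it is still 1 near a point of
  \<open>Z\<close>.\<close>

lemma dominates_derived:
  assumes K: "compact (UNIV :: 'k::t2_space set)"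
  shows "dominates TYPE('s::{real_normed_field, euclidean_space}) (derived :: 'k set \<Rightarrow> 'k set)"
  unfolding dominates_def
proof (intro allI impI)
  fix A :: "'k set" and B and R :: "('k \<Rightarrow>\<^sub>C 's) \<Rightarrow> ('k \<Rightarrow>\<^sub>C 's) \<Rightarrow> bool" and e :: real and Z H and p :: 'k
  assume A: "closed A" "derived A = {}" and R: "liftable B R" and e: "0 < e"
    and Z: "closed Z" "p \<in> derived Z" and H: "open H" "p \<in> H"
  have "compact A" using closed_Int_compact[OF A(1) K] by simp
  then have fin: "finite A"
    using Heine_Borel_imp_Bolzano_Weierstrass[of A A] A(2) unfolding derived_def by blast
  let ?good = "\<lambda>(h :: 'k \<Rightarrow>\<^sub>C 's, U, V). norm h \<le> 1 \<and> open U \<and> p \<in> U \<and> (\<forall>x\<in>U. apply_bcontfun h x = 0) \<and>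
      open V \<and> V \<subseteq> H \<and> V \<inter> Z \<noteq> {} \<and> (\<forall>x\<in>V. apply_bcontfun h x = 1)"
  \<comment> \<open>As \<open>p\<close> is a limit point of \<open>Z\<close>, there is a point
    \<open>z\<close> of \<open>Z\<close> near \<open>p\<close> but distinct from it. The function
    \<open>h\<close> is 0 near \<open>p\<close> and 1 near \<open>z\<close>.\<close>
  have step: "\<exists>s. ?good s \<and> fst (snd s) \<subseteq> W \<and> snd (snd s) \<subseteq> W" if W: "open W" "p \<in> W" for W
  proof -
    have "open (W \<inter> H)" "p \<in> W \<inter> H" using W H by auto
    then obtain z where z: "z \<in> Z" "z \<in> W \<inter> H" "z \<noteq> p"
      using Z(2) unfolding derived_def islimpt_def by blast
    obtain h :: "'k \<Rightarrow>\<^sub>C 's" and U V where "norm h \<le> 1" "open U" "p \<in> U" "\<And>x. x \<in> U \<Longrightarrow> h x = 0"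
      "open V" "z \<in> V" "\<And>x. x \<in> V \<Longrightarrow> h x = 1"
      using bump_function[OF K z(3)[symmetric]] by metis
    then show ?thesis
      using z W H by (intro exI[of _ "(h, U \<inter> W, V \<inter> (W \<inter> H))"]) auto
  qed
  \<comment> \<open>Each triple is chosen inside the previous neighbourhood \<open>U\<close> of
    \<open>p\<close>, so all earlier functions vanish on the new set \<open>V\<close>.\<close>
  have "\<exists>s. \<forall>n. ?good (s n) \<and> (fst (snd (s (Suc n))) \<subseteq> fst (snd (s n)) \<and> snd (snd (s (Suc n))) \<subseteq> fst (snd (s n)))"
  proof (rule dependent_nat_choice)
    show "\<exists>s. ?good s" using step[OF H] by blast
    show "\<exists>t. ?good t \<and> (fst (snd t) \<subseteq> fst (snd s) \<and> snd (snd t) \<subseteq> fst (snd s))" if "?good s" for s n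
      using that step[of "fst (snd s)"] by auto
  qed
  then obtain s where s: "\<forall>n. ?good (s n) \<and>
      (fst (snd (s (Suc n))) \<subseteq> fst (snd (s n)) \<and> snd (snd (s (Suc n))) \<subseteq> fst (snd (s n)))" ..
  then have good: "?good (s n)"
    and sub: "fst (snd (s (Suc n))) \<subseteq> fst (snd (s n))" "snd (snd (s (Suc n))) \<subseteq> fst (snd (s n))" for n
    by (simp_all only: )
  define h U V where "h n = fst (s n)" and "U n = fst (snd (s n))" and "V n = snd (snd (s n))" for n
  have hUV: "norm (h n) \<le> 1" "\<And>x. x \<in> U n \<Longrightarrow> h n x = 0" "open (V n)" "V n \<subseteq> H" "V n \<inter> Z \<noteq> {}"
      "\<And>x. x \<in> V n \<Longrightarrow> h n x = 1" for n
    using good[of n] by (auto simp: h_def U_def V_def split_def)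
  have VU: "V j \<subseteq> U i" if "i < j" for i j
  proof -
    have "antimono U" unfolding antimono_iff_le_Suc using sub(1) by (simp add: U_def)
    then have "U (j - 1) \<subseteq> U i" by (rule antimonoD) (use that in simp)
    moreover have "V j \<subseteq> U (j - 1)" using sub(2)[of "j - 1"] that by (simp add: U_def V_def)
    ultimately show ?thesis by blast
  qed
  obtain g where g: "\<And>n. R (h n) (g n)" "\<And>n. norm (g n) \<le> B"
    using liftableD(4)[OF R hUV(1)] by metis
  have "bounded (range (\<lambda>n. g n x))" for x
    unfolding bounded_iff using g(2) norm_bounded order_trans by blast
  then obtain i j where ij: "i < j" "\<And>x. x \<in> A \<Longrightarrow> dist (g i x) (g j x) < e"
    using finite_pigeonhole[OF fin _ e, of "\<lambda>n. apply_bcontfun (g n)"] by blast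
  \<comment> \<open>The later function minus the earlier one: on \<open>V j\<close> the former is 1
    and the latter 0. Subtracting two lifts accounts for the factor 2 in
    \<open>2 * B\<close>.\<close>
  have "norm (g j - g i) \<le> 2 * B"
    using norm_triangle_ineq4[of "g j" "g i"] g(2)[of i] g(2)[of j] by simp
  moreover have "norm ((g j - g i) x) \<le> e" if "x \<in> A" for x
    using ij(2)[OF that] by (simp add: dist_norm norm_minus_commute)
  moreover have "(h j - h i) x = 1" if "x \<in> V j" for x
    using that hUV(2,6) VU[OF ij(1)] by auto
  ultimately show "\<exists>f g V. R f g \<and> norm g \<le> 2 * B \<and> (\<forall>x\<in>A. norm (g x) \<le> e) \<and>
      open V \<and> V \<subseteq> H \<and> V \<inter> Z \<noteq> {} \<and> (\<forall>x\<in>V. f x = 1)"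
    using liftableD(3)[OF R g(1)[of j] g(1)[of i]] hUV(3,4,5)[of j] by blast
qed

lemma derivation_finite_Union:
  assumes "derivation F" "finite I" "\<And>i. i \<in> I \<Longrightarrow> closed (A i)"
  shows "F (\<Union>i\<in>I. A i) \<subseteq> (\<Union>i\<in>I. F (A i))"
  using assms(2,3)
proof (induction I)
  case empty
  show ?case using derivationD(3)[OF assms(1), of "{}"] by simp
next
  case (insert i I)
  have "F (A i \<union> (\<Union>i\<in>I. A i)) \<subseteq> F (A i) \<union> F (\<Union>i\<in>I. A i)"
    using insert by (intro derivationD(5)[OF assms(1)] closed_UN) auto
  also have "\<dots> \<subseteq> F (A i) \<union> (\<Union>i\<in>I. F (A i))" using insert by blast
  finally show ?case by simp
qed

text \<open>The partial sum \<open>s\<close> is smaller on \<open>F\<^sup>k\<^sup>+\<^sup>1 A\<close> than the bound asked for on \<open>F\<^sup>k A\<close>, with \<open>2 B\<close> to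
  spare near \<open>F\<^sup>k\<^sup>+\<^sup>1 A\<close>; away from it, \<open>F\<close> annihilates what remains of \<open>F\<^sup>k A\<close>, so that \<open>g\<close> can be made small there.\<close>

lemma dominates_step:
  fixes R :: "('k::t2_space \<Rightarrow>\<^sub>C 's::real_normed_field) \<Rightarrow> ('k \<Rightarrow>\<^sub>C 's) \<Rightarrow> bool"
    and s :: "'k \<Rightarrow>\<^sub>C 's" and F :: "'k set \<Rightarrow> 'k set"
  assumes F: "derivation F" "dominates TYPE('s) F"
    and A: "closed A" "(F ^^ m) A = {}"
    and R: "liftable B R" and Z: "closed Z" "p \<in> F Z" and H: "open H" "p \<in> H" and d: "0 < d"
    and s: "\<And>k x. x \<in> (F ^^ k) A \<Longrightarrow> norm (s x) \<le> 2 * B * (real m - real k) + c"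
  obtains f g V where "R f g" "norm g \<le> 2 * B"
    "\<And>k x. x \<in> (F ^^ k) A \<Longrightarrow> norm (apply_bcontfun (s + g) x) \<le> 2 * B * (real m - real k) + (c + d)"
    "open V" "V \<subseteq> H" "V \<inter> Z \<noteq> {}" "\<And>x. x \<in> V \<Longrightarrow> f x = 1"
proof -
  define U where "U k = {x. norm (s x) < 2 * B * (real m - real k) + (c + d)}" for k
  \<comment> \<open>The points at level \<open>k\<close> where \<open>s\<close> may have no
    \<open>2 * B\<close> to spare. The levels \<open>k < m\<close> are all of them, since
    \<open>(F ^^ m) A\<close> is empty.\<close>
  define A' where "A' = (\<Union>k<m. (F ^^ k) A - U (Suc k))"
  have "open (U k)" for k
    unfolding U_def by (intro open_Collect_less continuous_intros) auto
  then have closed: "closed ((F ^^ k) A - U (Suc k))" for k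
    using derivation_funpow(1)[OF F(1) A(1)] by (intro closed_Diff)
  have "F ((F ^^ k) A - U (Suc k)) = {}" for k
  proof -
    have "F ((F ^^ k) A - U (Suc k)) \<subseteq> (F ^^ Suc k) A"
      using derivationD(1)[OF F(1), of "(F ^^ k) A - U (Suc k)" "(F ^^ k) A"] by auto
    \<comment> \<open>The slack \<open>d\<close> makes the bound strict on the next derivative,
      which therefore lies in \<open>U (Suc k)\<close>. So \<open>F\<close> of the remainder lies
      both inside and outside this set.\<close>
    also have "\<dots> \<subseteq> U (Suc k)" using s[of _ "Suc k"] d unfolding U_def by fastforce
    finally show ?thesis using derivationD(3)[OF F(1), of "(F ^^ k) A - U (Suc k)"] by blast
  qed
  then have "F A' = {}"
    using derivation_finite_Union[OF F(1), of "{..<m}" "\<lambda>k. (F ^^ k) A - U (Suc k)"] closed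
    unfolding A'_def by auto
  moreover have "closed A'" unfolding A'_def using closed by (intro closed_UN) auto
  ultimately obtain f g V where fg: "R f g" "norm g \<le> 2 * B" "\<And>x. x \<in> A' \<Longrightarrow> norm (g x) \<le> d"
      "open V" "V \<subseteq> H" "V \<inter> Z \<noteq> {}" "\<And>x. x \<in> V \<Longrightarrow> f x = 1"
    using dominatesD[OF F(2) _ _ R d Z H] by metis
  have "norm (apply_bcontfun (s + g) x) \<le> 2 * B * (real m - real k) + (c + d)" if x: "x \<in> (F ^^ k) A" for k x
  proof -
    have "k < m" by (rule funpow_empty_less[OF F(1) A(2) x])
    have tri: "norm (apply_bcontfun (s + g) x) \<le> norm (s x) + norm (g x)" by (simp add: norm_triangle_ineq)
    show ?thesis
    proof (cases "x \<in> U (Suc k)")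
      case True
      \<comment> \<open>The full size \<open>2 * B\<close> of \<open>g\<close> is paid for by the
        difference between the bounds of levels \<open>k + 1\<close> and \<open>k\<close>.\<close>
      moreover have "norm (g x) \<le> 2 * B" using fg(2) norm_bounded order_trans by blast
      ultimately show ?thesis using tri by (simp add: U_def algebra_simps)
    next
      case False
      then have "x \<in> A'" using x \<open>k < m\<close> unfolding A'_def by blast
      then show ?thesis using fg(3) s[OF x] tri by fastforce
    qed
  qed
  then show thesis using fg that by blast
qed

text \<open>Since \<open>p\<close> lies in \<open>(F ^^ r) Z\<close> for every \<open>r\<close>, one
  can add \<open>r\<close> functions that are all 1 on a common open set, while the lift of the sum
  stays below \<open>2 * B * m + r * e / 2\<close> on \<open>A\<close>. Dividing by a large
  \<open>r\<close> makes the first term negligible.\<close>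

lemma dominates_omega:
  assumes K: "compact (UNIV :: 'k::t2_space set)"
    and F: "derivation (F :: 'k set \<Rightarrow> 'k set)" "dominates TYPE('s::real_normed_field) F"
  shows "dominates TYPE('s) (INF n. F ^^ n)"
  unfolding dominates_def
proof (intro allI impI)
  fix A :: "'k set" and B and R :: "('k \<Rightarrow>\<^sub>C 's) \<Rightarrow> ('k \<Rightarrow>\<^sub>C 's) \<Rightarrow> bool" and e :: real and Z H and p :: 'k
  assume A: "closed A" "(INF n. F ^^ n) A = {}" and R: "liftable B R" and e: "0 < e"
    and Z: "closed Z" "p \<in> (INF n. F ^^ n) Z" and H: "open H" "p \<in> H"
  have "compact A" using closed_Int_compact[OF A(1) K] by simp
  then obtain m where m: "(F ^^ m) A = {}" using derivation_omega_empty[OF F(1)] A(2) by blast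
  have B: "0 \<le> B" by (rule liftableD(6)[OF R])
  \<comment> \<open>\<open>Z\<close> is kept general because the induction hypothesis is applied to
    \<open>F Z\<close>: the point of \<open>F Z\<close> that it leaves in \<open>V\<close> is where
    the next function is chosen, relative to \<open>Z\<close>.\<close>
  have iter: "\<exists>f g V. R f g \<and> norm g \<le> 2 * B * real r \<and>
      (\<forall>k. \<forall>x\<in>(F ^^ k) A. norm (g x) \<le> 2 * B * (real m - real k) + real r * (e / 2)) \<and>
      open V \<and> V \<subseteq> H \<and> V \<inter> Z \<noteq> {} \<and> (\<forall>x\<in>V. f x = of_nat r)"
    if "closed Z" "p \<in> (F ^^ r) Z" for r Z
    using that
  proof (induction r arbitrary: Z)
    case 0
    have "0 \<le> 2 * B * (real m - real k)" if "x \<in> (F ^^ k) A" for k x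
      using B funpow_empty_less[OF F(1) m that] by simp
    then show ?case
      using liftableD(5)[OF R] 0 H by (intro exI[of _ 0] exI[of _ H]) auto
  next
    case (Suc r)
    have "p \<in> (F ^^ r) (F Z)" using Suc.prems(2) by (simp add: funpow_swap1)
    then obtain f g V where fg: "R f g" "norm g \<le> 2 * B * real r"
        "\<And>k x. x \<in> (F ^^ k) A \<Longrightarrow> norm (g x) \<le> 2 * B * (real m - real k) + real r * (e / 2)"
        "open V" "V \<subseteq> H" "V \<inter> F Z \<noteq> {}" "\<And>x. x \<in> V \<Longrightarrow> f x = of_nat r"
      using Suc.IH[OF derivationD(4)[OF F(1) Suc.prems(1)]] by metis
    then obtain q where q: "q \<in> F Z" "q \<in> V" by blast
    obtain f' g' V' where fg': "R f' g'" "norm g' \<le> 2 * B"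
        "\<And>k x. x \<in> (F ^^ k) A \<Longrightarrow> norm (apply_bcontfun (g + g') x) \<le> 2 * B * (real m - real k) + (real r * (e / 2) + e / 2)"
        "open V'" "V' \<subseteq> V" "V' \<inter> Z \<noteq> {}" "\<And>x. x \<in> V' \<Longrightarrow> f' x = 1"
      using dominates_step[OF F A(1) m R Suc.prems(1) q(1) fg(4) q(2) half_gt_zero[OF e] fg(3)] by metis
    have "norm (g + g') \<le> 2 * B * real (Suc r)"
      using norm_triangle_ineq[of g g'] fg(2) fg'(2) by (simp add: algebra_simps)
    moreover have "norm (apply_bcontfun (g + g') x) \<le> 2 * B * (real m - real k) + real (Suc r) * (e / 2)"
      if "x \<in> (F ^^ k) A" for k x
      using fg'(3)[OF that] by (simp add: algebra_simps add_divide_distrib)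
    moreover have "(f + f') x = of_nat (Suc r)" if "x \<in> V'" for x
      using that fg(7) fg'(5,7) by auto
    ultimately show ?case
      using liftableD(1)[OF R fg(1) fg'(1)] fg'(4,6) order_trans[OF fg'(5) fg(5)]
      by (blast intro: exI[of _ "f + f'"] exI[of _ "g + g'"] exI[of _ V'])
  qed
  \<comment> \<open>So large that \<open>2 * B * m\<close> is at most half of
    \<open>r * e\<close>.\<close>
  obtain r :: nat where r: "2 * B * real m / (e / 2) < real r" using reals_Archimedean2 by blast
  then have "0 < real r" using B e by (smt (verit) divide_nonneg_pos mult_nonneg_nonneg of_nat_0_le_iff half_gt_zero)
  then have r0: "0 < r" by simp
  have "p \<in> (F ^^ r) Z" using Z(2) by auto
  then obtain f g V where fg: "R f g" "norm g \<le> 2 * B * real r"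
      "\<And>k x. x \<in> (F ^^ k) A \<Longrightarrow> norm (g x) \<le> 2 * B * (real m - real k) + real r * (e / 2)"
      "open V" "V \<subseteq> H" "V \<inter> Z \<noteq> {}" "\<And>x. x \<in> V \<Longrightarrow> f x = of_nat r"
    using iter[OF Z(1)] by metis
  have "norm ((1 / real r) *\<^sub>R g) \<le> 2 * B" using fg(2) r0 by (simp add: field_simps)
  moreover have "norm (((1 / real r) *\<^sub>R g) x) \<le> e" if "x \<in> A" for x
  proof -
    have "norm (g x) \<le> 2 * B * real m + real r * (e / 2)" using fg(3)[of x 0] that by simp
    also have "\<dots> \<le> real r * e" using r e r0 by (simp add: field_simps)
    finally show ?thesis using r0 by (simp add: field_simps)
  qed
  moreover have "((1 / real r) *\<^sub>R f) x = 1" if "x \<in> V" for x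
    using fg(7)[OF that] r0 by (simp add: scaleR_conv_of_real)
  ultimately show "\<exists>f g V. R f g \<and> norm g \<le> 2 * B \<and> (\<forall>x\<in>A. norm (g x) \<le> e) \<and>
      open V \<and> V \<subseteq> H \<and> V \<inter> Z \<noteq> {} \<and> (\<forall>x\<in>V. f x = 1)"
    using liftableD(2)[OF R fg(1)] fg(4,5,6) by blast
qed

text \<open>For the infimum of a chain, compactness gives a member \<open>F\<close> with
  \<open>F A = {}\<close>. As \<open>p\<close> lies in the derivative by every member, the property
  of \<open>F\<close> applies directly.\<close>

lemma power_op_dominates:
  assumes K: "compact (UNIV :: 'k::t2_space set)" and F: "power_op (F :: 'k set \<Rightarrow> 'k set)"
  shows "dominates TYPE('s::{real_normed_field, euclidean_space}) F"
  using F
proof (induction rule: power_op.induct)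
  case derived
  show ?case by (rule dominates_derived[OF K])
next
  case (omega F)
  then show ?case using dominates_omega[OF K power_op_derivation] by blast
next
  case (chain \<F>)
  show ?case
    unfolding dominates_def
  proof (intro allI impI)
    fix A :: "'k set" and B and R :: "('k \<Rightarrow>\<^sub>C 's) \<Rightarrow> ('k \<Rightarrow>\<^sub>C 's) \<Rightarrow> bool" and e :: real and Z H and p :: 'k
    assume A: "closed A" "(Inf \<F>) A = {}" and R: "liftable B R" and e: "0 < e"
      and Z: "closed Z" "p \<in> (Inf \<F>) Z" and H: "open H" "p \<in> H"
    have "compact A" using closed_Int_compact[OF A(1) K] by simp
    then obtain F where F: "F \<in> \<F>" "F A = {}"
      using derivation_chain_empty[OF chain(1) power_op_derivation[OF chain(2)] chain(3) _ A(2)] by blast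
    have "p \<in> F Z" using Z(2) F(1) by auto
    from dominatesD[OF chain(4)[OF F(1)] A(1) F(2) R e Z(1) this H]
    show "\<exists>f g V. R f g \<and> norm g \<le> 2 * B \<and> (\<forall>x\<in>A. norm (g x) \<le> e) \<and>
        open V \<and> V \<subseteq> H \<and> V \<inter> Z \<noteq> {} \<and> (\<forall>x\<in>V. f x = 1)" by metis
  qed
qed

text \<open>Here \<open>A\<close> and \<open>Z\<close> are the whole space, and the operators are
  treated one after the other. The bound \<open>2 * B * m\<close> at level 0 does not grow with
  their number; only the errors \<open>d\<close> accumulate.\<close>

lemma scattered_bounded_sums:
  assumes K: "compact (UNIV :: 'k::t2_space set)" "scattered (UNIV :: 'k set)" "infinite (UNIV :: 'k set)"
  obtains C where "\<And>n (R :: nat \<Rightarrow> ('k \<Rightarrow>\<^sub>C 's::{real_normed_field, euclidean_space}) \<Rightarrow> ('k \<Rightarrow>\<^sub>C 's) \<Rightarrow> bool).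
    (\<And>i. liftable B (R i)) \<Longrightarrow>
    \<exists>f g x. (\<forall>i<n. R i (f i) (g i) \<and> apply_bcontfun (f i) (x i) = 1) \<and> norm (\<Sum>i<n. g i) \<le> C"
proof -
  obtain F m where Fm: "power_op F" "F (UNIV :: 'k set) \<noteq> {}" "(F ^^ m) (UNIV :: 'k set) = {}"
    using scattered_power_op_height[OF K] by metis
  have F: "derivation F" "dominates TYPE('s) F"
    using power_op_derivation power_op_dominates[OF K(1)] Fm(1) by blast+
  obtain p where p: "p \<in> F UNIV" using Fm(2) by blast
  have "\<exists>f g x. (\<forall>i<n. R i (f i) (g i) \<and> apply_bcontfun (f i) (x i) = 1) \<and> norm (\<Sum>i<n. g i) \<le> 2 * B * real m + 1"
    if R: "\<And>i. liftable B (R i)" for n and R :: "nat \<Rightarrow> ('k \<Rightarrow>\<^sub>C 's) \<Rightarrow> ('k \<Rightarrow>\<^sub>C 's) \<Rightarrow> bool"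
  proof -
    have B: "0 \<le> B" by (rule liftableD(6)[OF R])
    \<comment> \<open>The \<open>n\<close> errors then add up to at most 1.\<close>
    define d where "d = 1 / real (Suc n)"
    have d: "0 < d" by (simp add: d_def)
    have "\<exists>f g x. (\<forall>i<r. R i (f i) (g i) \<and> apply_bcontfun (f i) (x i) = 1) \<and>
        (\<forall>k. \<forall>y\<in>(F ^^ k) UNIV. norm (apply_bcontfun (\<Sum>i<r. g i) y) \<le> 2 * B * (real m - real k) + real r * d)" for r
    proof (induction r)
      case 0
      have "0 \<le> 2 * B * (real m - real k)" if "x \<in> (F ^^ k) UNIV" for k x
        using B funpow_empty_less[OF F(1) Fm(3) that] by simp
      then show ?case by simp
    next
      case (Suc r)
      then obtain f g x where fg: "\<And>i. i < r \<Longrightarrow> R i (f i) (g i) \<and> apply_bcontfun (f i) (x i) = 1"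
          "\<And>k y. y \<in> (F ^^ k) UNIV \<Longrightarrow> norm (apply_bcontfun (\<Sum>i<r. g i) y) \<le> 2 * B * (real m - real k) + real r * d"
        by blast
      obtain f' g' V where fg': "R r f' g'"
          "\<And>k y. y \<in> (F ^^ k) UNIV \<Longrightarrow> norm (apply_bcontfun ((\<Sum>i<r. g i) + g') y) \<le> 2 * B * (real m - real k) + (real r * d + d)"
          "V \<inter> UNIV \<noteq> {}" "\<And>x. x \<in> V \<Longrightarrow> apply_bcontfun f' x = 1"
        using dominates_step[OF F closed_UNIV Fm(3) R closed_UNIV p open_UNIV UNIV_I d fg(2)] by metis
      then obtain z where z: "z \<in> V" by blast
      have eq: "(\<Sum>i<Suc r. (g(r := g')) i) = (\<Sum>i<r. g i) + g'" by simp
      have rd: "real r * d + d = real (Suc r) * d" by (simp add: algebra_simps)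
      show ?case
        by (rule exI[of _ "f(r := f')"], rule exI[of _ "g(r := g')"], rule exI[of _ "x(r := z)"])
          (use fg(1) fg'(1,4) z fg'(2)[unfolded rd] eq in \<open>auto simp: less_Suc_eq simp del: plus_bcontfun.rep_eq\<close>)
    qed
    from this[of n] obtain f g x where fg: "\<And>i. i < n \<Longrightarrow> R i (f i) (g i) \<and> apply_bcontfun (f i) (x i) = 1"
        "\<And>k y. y \<in> (F ^^ k) UNIV \<Longrightarrow> norm (apply_bcontfun (\<Sum>i<n. g i) y) \<le> 2 * B * (real m - real k) + real n * d"
      by blast
    have "norm (apply_bcontfun (\<Sum>i<n. g i) y) \<le> 2 * B * real m + 1" for y
    proof -
      have "real n * d \<le> 1" by (simp add: d_def)
      then show ?thesis using fg(2)[of y 0] by simp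
    qed
    then have "norm (\<Sum>i<n. g i) \<le> 2 * B * real m + 1" by (rule norm_bound)
    then show ?thesis using fg(1) by blast
  qed
  then show thesis by (rule that)
qed

section \<open>Quotients and completions\<close>

text \<open>Laws relative to the carrier, with \<open>vscale V (- 1) x\<close> as the inverse of
  \<open>x\<close>. The function spaces, the algebraic tensor product and the space of Cauchy
  sequences are all instances.\<close>

locale vspace =
  fixes V :: "('s::real_normed_field, 'v) nspace"
  assumes zero_closed: "vzero V \<in> vcarrier V"
    and add_closed: "x \<in> vcarrier V \<Longrightarrow> y \<in> vcarrier V \<Longrightarrow> vadd V x y \<in> vcarrier V"
    and scale_closed: "x \<in> vcarrier V \<Longrightarrow> vscale V c x \<in> vcarrier V"
    and add_assoc: "x \<in> vcarrier V \<Longrightarrow> y \<in> vcarrier V \<Longrightarrow> z \<in> vcarrier V \<Longrightarrow>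
      vadd V (vadd V x y) z = vadd V x (vadd V y z)"
    and add_commute: "x \<in> vcarrier V \<Longrightarrow> y \<in> vcarrier V \<Longrightarrow> vadd V x y = vadd V y x"
    and add_zero: "x \<in> vcarrier V \<Longrightarrow> vadd V x (vzero V) = x"
    and add_minus: "x \<in> vcarrier V \<Longrightarrow> vadd V x (vscale V (- 1) x) = vzero V"
    and scale_add: "x \<in> vcarrier V \<Longrightarrow> y \<in> vcarrier V \<Longrightarrow>
      vscale V c (vadd V x y) = vadd V (vscale V c x) (vscale V c y)"
    and scale_scale: "x \<in> vcarrier V \<Longrightarrow> vscale V c (vscale V d x) = vscale V (c * d) x"
begin

lemma add_swap:
  assumes "x \<in> vcarrier V" "y \<in> vcarrier V" "z \<in> vcarrier V" "w \<in> vcarrier V"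
  shows "vadd V (vadd V x y) (vadd V z w) = vadd V (vadd V x z) (vadd V y w)"
  using assms by (metis add_assoc add_closed add_commute)

lemma diff_closed: "x \<in> vcarrier V \<Longrightarrow> y \<in> vcarrier V \<Longrightarrow> vdiff V x y \<in> vcarrier V"
  by (simp add: vdiff_def add_closed scale_closed)

lemma diff_add:
  assumes "x \<in> vcarrier V" "y \<in> vcarrier V" "z \<in> vcarrier V" "w \<in> vcarrier V"
  shows "vdiff V (vadd V x y) (vadd V z w) = vadd V (vdiff V x z) (vdiff V y w)"
  unfolding vdiff_def using assms by (simp add: scale_add scale_closed add_swap)

lemma diff_scale:
  assumes "x \<in> vcarrier V" "y \<in> vcarrier V"
  shows "vdiff V (vscale V c x) (vscale V c y) = vscale V c (vdiff V x y)"
  unfolding vdiff_def using assms by (simp add: scale_add scale_closed scale_scale mult.commute)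

definition linear_subset :: "'v set \<Rightarrow> bool" where
  "linear_subset M \<longleftrightarrow> M \<subseteq> vcarrier V \<and> vzero V \<in> M \<and>
    (\<forall>x\<in>M. \<forall>y\<in>M. vadd V x y \<in> M) \<and> (\<forall>c. \<forall>x\<in>M. vscale V c x \<in> M)"

lemma linear_subsetD:
  assumes "linear_subset M"
  shows "x \<in> M \<Longrightarrow> x \<in> vcarrier V" "vzero V \<in> M" "x \<in> M \<Longrightarrow> y \<in> M \<Longrightarrow> vadd V x y \<in> M"
    "x \<in> M \<Longrightarrow> vscale V c x \<in> M"
  using assms unfolding linear_subset_def by blast+

lemma coset_add:
  assumes M: "linear_subset M" and xy: "x \<in> vcarrier V" "y \<in> vcarrier V"
  shows "vadd (quotient_space V M) (coset V M x) (coset V M y) = coset V M (vadd V x y)"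
proof -
  note M = linear_subsetD[OF M]
  have "{vadd V a b | a b. a \<in> coset V M x \<and> b \<in> coset V M y} = coset V M (vadd V x y)"
  proof (intro equalityI subsetI)
    fix w assume "w \<in> {vadd V a b | a b. a \<in> coset V M x \<and> b \<in> coset V M y}"
    then obtain m n where mn: "m \<in> M" "n \<in> M" and w: "w = vadd V (vadd V x m) (vadd V y n)"
      unfolding coset_def by blast
    have "w = vadd V (vadd V x y) (vadd V m n)" unfolding w by (rule add_swap) (use xy M mn in auto)
    then show "w \<in> coset V M (vadd V x y)" using M(3)[OF mn] unfolding coset_def by blast
  next
    fix w assume "w \<in> coset V M (vadd V x y)"
    then obtain m where m: "m \<in> M" and w: "w = vadd V (vadd V x y) m" unfolding coset_def by blast
    have "w = vadd V (vadd V x m) (vadd V y (vzero V))"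
      using xy M(1)[OF m] add_swap[of x y m "vzero V"] by (simp add: w add_zero zero_closed)
    then show "w \<in> {vadd V a b | a b. a \<in> coset V M x \<and> b \<in> coset V M y}"
      using m M(2) unfolding coset_def by blast
  qed
  then show ?thesis by (simp add: quotient_space_def)
qed

lemma coset_scale:
  assumes M: "linear_subset M" and x: "x \<in> vcarrier V"
  shows "vscale (quotient_space V M) c (coset V M x) = coset V M (vscale V c x)"
proof -
  note M = linear_subsetD[OF M]
  have "{vadd V (vscale V c a) m | a m. a \<in> coset V M x \<and> m \<in> M} = coset V M (vscale V c x)"
  proof (intro equalityI subsetI)
    fix w assume "w \<in> {vadd V (vscale V c a) m | a m. a \<in> coset V M x \<and> m \<in> M}"
    then obtain m n where mn: "m \<in> M" "n \<in> M" and w: "w = vadd V (vscale V c (vadd V x m)) n"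
      unfolding coset_def by blast
    have "w = vadd V (vscale V c x) (vadd V (vscale V c m) n)"
      using x M(1)[OF mn(1)] M(1)[OF mn(2)] by (simp add: w scale_add add_assoc scale_closed)
    then show "w \<in> coset V M (vscale V c x)" using M(3)[OF M(4)[OF mn(1)] mn(2)] unfolding coset_def by blast
  next
    fix w assume "w \<in> coset V M (vscale V c x)"
    then obtain m where m: "m \<in> M" and w: "w = vadd V (vscale V c (vadd V x (vzero V))) m"
      unfolding coset_def using add_zero[OF x] by auto
    then show "w \<in> {vadd V (vscale V c a) m | a m. a \<in> coset V M x \<and> m \<in> M}"
      using M(2) unfolding coset_def by blast
  qed
  then show ?thesis by (simp add: quotient_space_def)
qed

lemma mem_coset_self: "linear_subset M \<Longrightarrow> x \<in> vcarrier V \<Longrightarrow> x \<in> coset V M x"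
  using add_zero[of x] linear_subsetD(2)[of M] unfolding coset_def by force

lemma coset_eq:
  assumes M: "linear_subset M" and x: "x \<in> vcarrier V" and y: "y \<in> coset V M x"
  shows "y \<in> vcarrier V" "coset V M y = coset V M x"
proof -
  obtain m where m: "m \<in> M" "y = vadd V x m" using y by (auto simp: coset_def)
  have mV: "n \<in> vcarrier V" "vscale V c n \<in> M" "n' \<in> M \<Longrightarrow> vadd V n n' \<in> M" if "n \<in> M" for n n' c
    using linear_subsetD[OF M] that by blast+
  show "y \<in> vcarrier V" using m x mV by (simp add: add_closed)
  have "vadd V x n = vadd V y (vadd V (vscale V (- 1) m) n)" if n: "n \<in> M" for n
  proof -
    have "vadd V y (vadd V (vscale V (- 1) m) n) = vadd V (vadd V x (vadd V m (vscale V (- 1) m))) n"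
      using m x mV n by (simp add: add_assoc add_closed scale_closed)
    also have "\<dots> = vadd V x n" using m x mV by (simp add: add_minus add_zero)
    finally show ?thesis by simp
  qed
  moreover have "vadd V y n = vadd V x (vadd V m n)" if "n \<in> M" for n
    using m x mV that by (simp add: add_assoc)
  moreover have "vadd V (vscale V (- 1) m) n \<in> M" "vadd V m n \<in> M" if "n \<in> M" for n
    using mV m(1) that by blast+
  ultimately show "coset V M y = coset V M x"
    unfolding coset_def by (intro equalityI subsetI) blast+
qed

lemma closed_subspace_linear_subset: "closed_subspace V M \<Longrightarrow> linear_subset M"
  by (simp add: closed_subspace_def linear_subset_def)

end

text \<open>Seminorms fit the projective tensor norm as an infimum; the completion factors out the
  null sequences in any case.\<close>

locale seminormed = vspace +
  assumes norm_nonneg: "x \<in> vcarrier V \<Longrightarrow> 0 \<le> vnorm V x"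
    and norm_triangle: "x \<in> vcarrier V \<Longrightarrow> y \<in> vcarrier V \<Longrightarrow> vnorm V (vadd V x y) \<le> vnorm V x + vnorm V y"
    and norm_scale: "x \<in> vcarrier V \<Longrightarrow> vnorm V (vscale V c x) = norm c * vnorm V x"
    and norm_zero: "vnorm V (vzero V) = 0"
begin

definition null_seqs :: "(nat \<Rightarrow> 'b) set" where
  "null_seqs = {u. cauchy_seq V u \<and> (\<lambda>n. vnorm V (u n)) \<longlonglongrightarrow> 0}"

lemma cauchy_const: "x \<in> vcarrier V \<Longrightarrow> cauchy_seq V (\<lambda>n. x)"
  by (simp add: cauchy_seq_def vdiff_def add_minus norm_zero)

lemma cauchy_add:
  assumes "cauchy_seq V u" "cauchy_seq V w"
  shows "cauchy_seq V (\<lambda>n. vadd V (u n) (w n))"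
  unfolding cauchy_seq_def
proof (intro conjI allI impI)
  have c: "u n \<in> vcarrier V" "w n \<in> vcarrier V" for n using assms by (auto simp: cauchy_seq_def)
  then show "vadd V (u n) (w n) \<in> vcarrier V" for n by (simp add: add_closed)
  fix e :: real assume "0 < e"
  then have e: "0 < e / 2" by simp
  obtain M where M: "\<And>m n. m \<ge> M \<Longrightarrow> n \<ge> M \<Longrightarrow> vnorm V (vdiff V (u m) (u n)) < e / 2"
    using assms(1) e unfolding cauchy_seq_def by metis
  obtain N where N: "\<And>m n. m \<ge> N \<Longrightarrow> n \<ge> N \<Longrightarrow> vnorm V (vdiff V (w m) (w n)) < e / 2"
    using assms(2) e unfolding cauchy_seq_def by metis
  have "vnorm V (vdiff V (vadd V (u m) (w m)) (vadd V (u n) (w n))) < e" if "m \<ge> max M N" "n \<ge> max M N" for m n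
  proof -
    have "vnorm V (vdiff V (vadd V (u m) (w m)) (vadd V (u n) (w n))) \<le>
        vnorm V (vdiff V (u m) (u n)) + vnorm V (vdiff V (w m) (w n))"
      using c by (simp add: diff_add norm_triangle diff_closed)
    also have "\<dots> < e" using M[of m n] N[of m n] that by simp
    finally show ?thesis .
  qed
  then show "\<exists>N. \<forall>m\<ge>N. \<forall>n\<ge>N. vnorm V (vdiff V (vadd V (u m) (w m)) (vadd V (u n) (w n))) < e" by blast
qed

lemma cauchy_scale:
  assumes "cauchy_seq V u"
  shows "cauchy_seq V (\<lambda>n. vscale V c (u n))"
  unfolding cauchy_seq_def
proof (intro conjI allI impI)
  have u: "u n \<in> vcarrier V" for n using assms by (auto simp: cauchy_seq_def)
  then show "vscale V c (u n) \<in> vcarrier V" for n by (simp add: scale_closed)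
  fix e :: real assume "0 < e"
  then have "0 < e / (norm c + 1)" by (simp add: add_nonneg_pos)
  then obtain N where N: "\<And>m n. m \<ge> N \<Longrightarrow> n \<ge> N \<Longrightarrow> vnorm V (vdiff V (u m) (u n)) < e / (norm c + 1)"
    using assms unfolding cauchy_seq_def by metis
  have "vnorm V (vdiff V (vscale V c (u m)) (vscale V c (u n))) < e" if "m \<ge> N" "n \<ge> N" for m n
  proof -
    have "vnorm V (vdiff V (vscale V c (u m)) (vscale V c (u n))) = norm c * vnorm V (vdiff V (u m) (u n))"
      using u by (simp add: diff_scale norm_scale diff_closed)
    also have "\<dots> \<le> (norm c + 1) * vnorm V (vdiff V (u m) (u n))"
      using u by (intro mult_right_mono) (auto simp: norm_nonneg diff_closed)
    also have "\<dots> < e"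
      using N[OF that] by (simp add: pos_less_divide_eq add_nonneg_pos mult.commute)
    finally show ?thesis .
  qed
  then show "\<exists>N. \<forall>m\<ge>N. \<forall>n\<ge>N. vnorm V (vdiff V (vscale V c (u m)) (vscale V c (u n))) < e" by blast
qed

lemma cauchy_closed: "cauchy_seq V u \<Longrightarrow> u n \<in> vcarrier V"
  by (simp add: cauchy_seq_def)

lemma vspace_cauchy_space: "vspace (cauchy_space V)"
proof
  show "vzero (cauchy_space V) \<in> vcarrier (cauchy_space V)"
    using cauchy_const[OF zero_closed] by (simp add: cauchy_space_def)
qed (auto simp: cauchy_space_def cauchy_add cauchy_scale add_assoc add_zero add_minus scale_add scale_scale
      cauchy_closed intro!: ext add_commute)

lemma linear_subset_null_seqs: "vspace.linear_subset (cauchy_space V) null_seqs"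
proof -
  have "(\<lambda>n. vnorm V (vadd V (u n) (w n))) \<longlonglongrightarrow> 0"
    if "(\<lambda>n. vnorm V (u n)) \<longlonglongrightarrow> 0" "(\<lambda>n. vnorm V (w n)) \<longlonglongrightarrow> 0" "cauchy_seq V u" "cauchy_seq V w" for u w
  proof (rule Lim_null_comparison)
    show "(\<lambda>n. vnorm V (u n) + vnorm V (w n)) \<longlonglongrightarrow> 0" using tendsto_add[OF that(1,2)] by simp
    show "\<forall>\<^sub>F n in sequentially. norm (vnorm V (vadd V (u n) (w n))) \<le> vnorm V (u n) + vnorm V (w n)"
      using cauchy_closed that(3,4) by (simp add: norm_nonneg add_closed norm_triangle)
  qed
  moreover have "(\<lambda>n. vnorm V (vscale V c (u n))) \<longlonglongrightarrow> 0"
    if "(\<lambda>n. vnorm V (u n)) \<longlonglongrightarrow> 0" "cauchy_seq V u" for c u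
  proof -
    have "vnorm V (vscale V c (u n)) = norm c * vnorm V (u n)" for n
      using that(2) by (simp add: norm_scale cauchy_seq_def)
    then show ?thesis using tendsto_mult_left[OF that(1), of "norm c"] by simp
  qed
  ultimately show ?thesis
    unfolding vspace.linear_subset_def[OF vspace_cauchy_space] null_seqs_def
    by (auto simp: cauchy_space_def cauchy_add cauchy_scale cauchy_const zero_closed norm_zero)
qed

definition completion_map :: "'b \<Rightarrow> (nat \<Rightarrow> 'b) set" where
  "completion_map x = coset (cauchy_space V) null_seqs (\<lambda>n. x)"

lemma Banach_completion_eq: "Banach_completion V = quotient_space (cauchy_space V) null_seqs"
  by (simp add: Banach_completion_def null_seqs_def)

lemma completion_map_closed: "x \<in> vcarrier V \<Longrightarrow> completion_map x \<in> vcarrier (Banach_completion V)"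
  by (auto simp: Banach_completion_eq quotient_space_def completion_map_def cauchy_space_def cauchy_const)

lemma completion_map_add:
  assumes "x \<in> vcarrier V" "y \<in> vcarrier V"
  shows "vadd (Banach_completion V) (completion_map x) (completion_map y) = completion_map (vadd V x y)"
  using vspace.coset_add[OF vspace_cauchy_space linear_subset_null_seqs, of "\<lambda>n. x" "\<lambda>n. y"] assms
  by (simp add: Banach_completion_eq completion_map_def cauchy_space_def cauchy_const)

lemma completion_map_scale:
  assumes "x \<in> vcarrier V"
  shows "vscale (Banach_completion V) c (completion_map x) = completion_map (vscale V c x)"
  using vspace.coset_scale[OF vspace_cauchy_space linear_subset_null_seqs, of "\<lambda>n. x" c] assms
  by (simp add: Banach_completion_eq completion_map_def cauchy_space_def cauchy_const)

text \<open>Every member of the class is \<open>x\<close> plus a null sequence, and its norms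
  converge to that of \<open>x\<close>. So the infimum is over one value.\<close>

lemma completion_map_norm:
  assumes x: "x \<in> vcarrier V"
  shows "vnorm (Banach_completion V) (completion_map x) = vnorm V x"
proof -
  have "vnorm (cauchy_space V) w = vnorm V x" if w: "w \<in> completion_map x" for w
  proof -
    obtain z where z: "cauchy_seq V z" "(\<lambda>n. vnorm V (z n)) \<longlonglongrightarrow> 0" "w = (\<lambda>n. vadd V x (z n))"
      using w by (auto simp: completion_map_def coset_def null_seqs_def cauchy_space_def)
    have zn: "z n \<in> vcarrier V" for n using z(1) by (simp add: cauchy_seq_def)
    have "\<bar>vnorm V (w n) - vnorm V x\<bar> \<le> vnorm V (z n)" for n
    proof -
      have "vnorm V x = vnorm V (vadd V (w n) (vscale V (- 1) (z n)))"
        using x zn by (simp add: z(3) add_assoc add_minus add_zero scale_closed)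
      also have "\<dots> \<le> vnorm V (w n) + vnorm V (z n)"
        using norm_triangle[of "w n" "vscale V (- 1) (z n)"] x zn
        by (simp add: z(3) norm_scale add_closed scale_closed)
      finally show ?thesis
        using norm_triangle[OF x zn, of n] by (simp add: z(3) abs_le_iff)
    qed
    then have "(\<lambda>n. vnorm V (w n) - vnorm V x) \<longlonglongrightarrow> 0"
      by (intro Lim_null_comparison[OF _ z(2)]) simp
    then have "(\<lambda>n. vnorm V (w n)) \<longlonglongrightarrow> vnorm V x" by (simp add: LIM_zero_iff)
    then show ?thesis by (simp add: cauchy_space_def limI)
  qed
  moreover have "(\<lambda>n. x) \<in> completion_map x"
    unfolding completion_map_def
    using vspace.mem_coset_self[OF vspace_cauchy_space linear_subset_null_seqs] cauchy_const[OF x]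
    by (simp add: cauchy_space_def)
  ultimately have "vnorm (cauchy_space V) ` completion_map x = {vnorm V x}" by auto
  then show ?thesis by (simp add: Banach_completion_eq quotient_space_def)
qed

end

text \<open>The embedding \<open>T\<close> is replaced by the relation "\<open>y\<close> represents
  the image of \<open>x\<close>". It is additive and homogeneous, although a linear choice of
  representatives need not exist. The constant \<open>B\<close> comes from \<open>T\<close> and
  \<open>c\<close> from its inverse.\<close>

lemma embeds_in_quotient_relation:
  fixes V :: "('s::real_normed_field, 'v) nspace" and W :: "('s, 'w) nspace"
  assumes V: "seminormed V" and W: "seminormed W" and emb: "embeds_in_quotient (Banach_completion V) W"
  obtains R :: "'v \<Rightarrow> 'w \<Rightarrow> bool" and B c :: real where "0 \<le> B" "0 \<le> c"
    "\<And>x y x' y'. R x y \<Longrightarrow> R x' y' \<Longrightarrow> R (vadd V x x') (vadd W y y')"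
    "\<And>a x y. R x y \<Longrightarrow> R (vscale V a x) (vscale W a y)"
    "\<And>x. x \<in> vcarrier V \<Longrightarrow> \<exists>y. R x y \<and> vnorm W y \<le> B * vnorm V x + 1"
    "\<And>x y. R x y \<Longrightarrow> vnorm V x \<le> c * vnorm W y"
proof -
  interpret V: seminormed V by (rule V)
  interpret W: seminormed W by (rule W)
  let ?J = "V.completion_map" and ?V = "Banach_completion V"
  obtain M S where M: "closed_subspace W M" and S: "closed_subspace (quotient_space W M) S"
    and iso: "isomorphic ?V ((quotient_space W M)\<lparr>vcarrier := S\<rparr>)"
    using emb unfolding embeds_in_quotient_def by (elim exE conjE)
  obtain T T' where T: "bounded_linear_on ?V ((quotient_space W M)\<lparr>vcarrier := S\<rparr>) T"
    and T': "bounded_linear_on ((quotient_space W M)\<lparr>vcarrier := S\<rparr>) ?V T'"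
    and inv: "\<forall>x\<in>vcarrier ?V. T' (T x) = x"
    using iso unfolding isomorphic_def by (elim exE conjE)
  let ?Q = "quotient_space W M"
  have LM: "W.linear_subset M" by (rule W.closed_subspace_linear_subset[OF M])
  have Tlin: "T x \<in> S" "y \<in> vcarrier ?V \<Longrightarrow> T (vadd ?V x y) = vadd ?Q (T x) (T y)"
      "T (vscale ?V a x) = vscale ?Q a (T x)" if "x \<in> vcarrier ?V" for x y a
    using T that unfolding bounded_linear_on_def by simp_all
  have "\<exists>B. \<forall>x\<in>vcarrier ?V. vnorm ?Q (T x) \<le> B * vnorm ?V x"
    using T unfolding bounded_linear_on_def by simp
  then obtain B where B: "\<And>x. x \<in> vcarrier ?V \<Longrightarrow> vnorm ?Q (T x) \<le> B * vnorm ?V x" by blast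
  have "\<exists>c. \<forall>y\<in>S. vnorm ?V (T' y) \<le> c * vnorm ?Q y"
    using T' unfolding bounded_linear_on_def by simp
  then obtain c where c: "\<And>y. y \<in> S \<Longrightarrow> vnorm ?V (T' y) \<le> c * vnorm ?Q y" by blast
  define R where "R x y \<longleftrightarrow> x \<in> vcarrier V \<and> y \<in> vcarrier W \<and> T (?J x) = coset W M y" for x y
  have bdd: "bdd_below (vnorm W ` coset W M y)" if "y \<in> vcarrier W" for y
    using W.norm_nonneg W.coset_eq(1)[OF LM that] by (intro bdd_belowI[of _ 0]) auto
  have Qnonneg: "0 \<le> vnorm ?Q (coset W M y)" if "y \<in> vcarrier W" for y
    using W.mem_coset_self[OF LM that] W.norm_nonneg W.coset_eq(1)[OF LM that]
    unfolding quotient_space_def by (auto intro!: cINF_greatest)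
  show thesis
  proof (rule that[of "max B 0" "max c 0" R])
    show "R (vadd V x x') (vadd W y y')" if "R x y" "R x' y'" for x y x' y'
      using that Tlin(2)[of "?J x" "?J x'"] V.completion_map_add[of x x'] W.coset_add[OF LM, of y y']
      by (simp add: R_def V.add_closed W.add_closed V.completion_map_closed)
    show "R (vscale V a x) (vscale W a y)" if "R x y" for a x y
      using that Tlin(3)[of "?J x" a] V.completion_map_scale[of x a] W.coset_scale[OF LM, of y a]
      by (simp add: R_def V.scale_closed W.scale_closed V.completion_map_closed)
    show "\<exists>y. R x y \<and> vnorm W y \<le> max B 0 * vnorm V x + 1" if x: "x \<in> vcarrier V" for x
    proof -
      have "T (?J x) \<in> vcarrier ?Q"
        using Tlin(1)[OF V.completion_map_closed[OF x]] S unfolding closed_subspace_def by blast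
      then obtain y where y: "y \<in> vcarrier W" "T (?J x) = coset W M y"
        by (auto simp: quotient_space_def)
      have "Inf (vnorm W ` coset W M y) \<le> B * vnorm V x"
        using B[OF V.completion_map_closed[OF x]] V.completion_map_norm[OF x] y(2)
        by (simp add: quotient_space_def)
      also have "\<dots> \<le> max B 0 * vnorm V x"
        using V.norm_nonneg[OF x] by (intro mult_right_mono) auto
      also have "\<dots> < max B 0 * vnorm V x + 1" by simp
      \<comment> \<open>The infimum over a coset need not be attained; the additional 1 ensures that
        some representative obeys the bound.\<close>
      finally obtain y' where y': "y' \<in> coset W M y" "vnorm W y' < max B 0 * vnorm V x + 1"
        using cInf_lessD[of "vnorm W ` coset W M y" "max B 0 * vnorm V x + 1"] W.mem_coset_self[OF LM y(1)]
        by blast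
      then have "R x y'" using x y W.coset_eq[OF LM y(1) y'(1)] by (simp add: R_def)
      then show ?thesis using y'(2) by (meson less_imp_le)
    qed
    show "vnorm V x \<le> max c 0 * vnorm W y" if R: "R x y" for x y
    proof -
      have xy: "x \<in> vcarrier V" "y \<in> vcarrier W" "T (?J x) = coset W M y" using R by (auto simp: R_def)
      note J = V.completion_map_closed[OF xy(1)]
      have "vnorm V x = vnorm ?V (T' (T (?J x)))"
        by (simp add: bspec[OF inv J] V.completion_map_norm[OF xy(1)])
      also have "\<dots> \<le> c * vnorm ?Q (coset W M y)" using c[OF Tlin(1)[OF J]] xy(3) by simp
      also have "\<dots> \<le> max c 0 * vnorm ?Q (coset W M y)"
        using Qnonneg[OF xy(2)] by (intro mult_right_mono) auto
      also have "\<dots> \<le> max c 0 * vnorm W y"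
        using W.mem_coset_self[OF LM xy(2)] bdd[OF xy(2)]
        by (intro mult_left_mono) (auto simp: quotient_space_def intro!: cINF_lower)
      finally show ?thesis .
    qed
  qed auto
qed

section \<open>The projective tensor norm\<close>

definition tensor_cost :: "('s, 'v) nspace \<Rightarrow> ('s, 'w) nspace \<Rightarrow> ('v \<times> 'w) list \<Rightarrow> real" where
  "tensor_cost V W ps = (\<Sum>(x, y)\<leftarrow>ps. vnorm V x * vnorm W y)"

lemma tensor_sum_append: "tensor_sum V W (ps @ qs) = (\<lambda>A. tensor_sum V W ps A + tensor_sum V W qs A)"
  by (simp add: tensor_sum_def fun_eq_iff)

lemma tensor_cost_append: "tensor_cost V W (ps @ qs) = tensor_cost V W ps + tensor_cost V W qs"
  by (simp add: tensor_cost_def)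

locale tensor_factors = V: seminormed V + W: seminormed W
  for V :: "('s::real_normed_field, 'v) nspace" and W :: "('s, 'w) nspace"
begin

abbreviation "AT \<equiv> algebraic_tensor V W"
abbreviation "reps \<equiv> {ps. set ps \<subseteq> vcarrier V \<times> vcarrier W}"
abbreviation "left_scale \<equiv> \<lambda>c. map (\<lambda>(x, y). (vscale V c x, y))"

lemma cost_nonneg: "ps \<in> reps \<Longrightarrow> 0 \<le> tensor_cost V W ps"
  unfolding tensor_cost_def by (rule sum_list_nonneg) (auto simp: V.norm_nonneg W.norm_nonneg)

lemma tensor_carrier: "vcarrier AT = tensor_sum V W ` reps"
  by (auto simp: algebraic_tensor_def)

lemma tensor_norm: "vnorm AT u = Inf (tensor_cost V W ` {ps \<in> reps. u = tensor_sum V W ps})"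
  unfolding algebraic_tensor_def by (simp add: tensor_cost_def image_def) (metis (no_types, lifting))

lemma tensor_norm_le: "ps \<in> reps \<Longrightarrow> vnorm AT (tensor_sum V W ps) \<le> tensor_cost V W ps"
  unfolding tensor_norm using cost_nonneg by (intro cINF_lower bdd_belowI[of _ 0]) auto

lemma tensor_norm_ge:
  assumes "u \<in> vcarrier AT" "\<And>ps. ps \<in> reps \<Longrightarrow> u = tensor_sum V W ps \<Longrightarrow> b \<le> tensor_cost V W ps"
  shows "b \<le> vnorm AT u"
  unfolding tensor_norm using assms by (intro cINF_greatest) (auto simp: tensor_carrier)

lemma tensor_norm_approx:
  assumes "u \<in> vcarrier AT" "0 < e"
  obtains ps where "ps \<in> reps" "u = tensor_sum V W ps" "tensor_cost V W ps < vnorm AT u + e"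
proof -
  have "\<not> (vnorm AT u + e \<le> vnorm AT u)" using assms(2) by simp
  then show thesis using tensor_norm_ge[OF assms(1), of "vnorm AT u + e"] that by (meson not_le)
qed

lemma left_scale_reps: "ps \<in> reps \<Longrightarrow> left_scale c ps \<in> reps"
  by (auto simp: V.scale_closed)

lemma tensor_sum_left_scale:
  assumes "ps \<in> reps"
  shows "tensor_sum V W (left_scale c ps) = (\<lambda>A. c * tensor_sum V W ps A)"
proof
  fix A
  show "tensor_sum V W (left_scale c ps) A = c * tensor_sum V W ps A"
    using assms
    by (induction ps) (auto simp: tensor_sum_def elem_tensor_def bilinear_form_def distrib_left)
qed

lemma tensor_cost_left_scale:
  assumes "ps \<in> reps"
  shows "tensor_cost V W (left_scale c ps) = norm c * tensor_cost V W ps"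
  using assms by (induction ps) (auto simp: tensor_cost_def V.norm_scale algebra_simps)

lemma tensor_add_closed: "u \<in> vcarrier AT \<Longrightarrow> v \<in> vcarrier AT \<Longrightarrow> vadd AT u v \<in> vcarrier AT"
proof -
  assume "u \<in> vcarrier AT" "v \<in> vcarrier AT"
  then obtain ps qs where "ps \<in> reps" "qs \<in> reps" "u = tensor_sum V W ps" "v = tensor_sum V W qs"
    unfolding tensor_carrier by blast
  then have "vadd AT u v = tensor_sum V W (ps @ qs)" "ps @ qs \<in> reps"
    by (auto simp: algebraic_tensor_def tensor_sum_append)
  then show ?thesis unfolding tensor_carrier by blast
qed

lemma tensor_scale_closed: "u \<in> vcarrier AT \<Longrightarrow> vscale AT c u \<in> vcarrier AT"
proof -
  assume "u \<in> vcarrier AT"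
  then obtain ps where ps: "ps \<in> reps" "u = tensor_sum V W ps" unfolding tensor_carrier by blast
  then have "vscale AT c u = tensor_sum V W (left_scale c ps)"
    by (simp only: tensor_sum_left_scale) (simp add: algebraic_tensor_def)
  then show ?thesis unfolding tensor_carrier using left_scale_reps[OF ps(1)] by blast
qed

lemma tensor_norm_scale_le:
  assumes u: "u \<in> vcarrier AT"
  shows "vnorm AT (vscale AT c u) \<le> norm c * vnorm AT u"
proof (rule field_le_epsilon)
  fix e :: real assume "0 < e"
  then have "0 < e / (norm c + 1)" by (simp add: add_nonneg_pos)
  then obtain ps where ps: "ps \<in> reps" "u = tensor_sum V W ps" "tensor_cost V W ps < vnorm AT u + e / (norm c + 1)"
    using tensor_norm_approx[OF u] by metis
  have "vscale AT c u = tensor_sum V W (left_scale c ps)"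
    unfolding ps(2) tensor_sum_left_scale[OF ps(1)] by (simp add: algebraic_tensor_def)
  then have "vnorm AT (vscale AT c u) \<le> norm c * tensor_cost V W ps"
    using tensor_norm_le[OF left_scale_reps[OF ps(1)], of c] tensor_cost_left_scale[OF ps(1), of c] by simp
  also have "\<dots> \<le> norm c * (vnorm AT u + e / (norm c + 1))"
    using ps(3) by (intro mult_left_mono) auto
  also have "\<dots> = norm c * vnorm AT u + (norm c / (norm c + 1)) * e" by (simp add: distrib_left)
  also have "(norm c / (norm c + 1)) * e \<le> 1 * e"
    using \<open>0 < e\<close> by (intro mult_right_mono) (auto simp: divide_le_eq_1 add_nonneg_pos)
  finally show "vnorm AT (vscale AT c u) \<le> norm c * vnorm AT u + e" by simp
qed

lemma seminormed_tensor: "seminormed AT"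
proof
  have nonneg: "0 \<le> vnorm AT u" if "u \<in> vcarrier AT" for u
    by (rule tensor_norm_ge[OF that]) (rule cost_nonneg)
  show "vzero AT \<in> vcarrier AT"
    unfolding tensor_carrier
    by (rule image_eqI[of _ _ "[]"]) (auto simp: algebraic_tensor_def tensor_sum_def)
  show "vnorm AT (vzero AT) = 0"
  proof (rule antisym)
    have "vzero AT = tensor_sum V W []" by (auto simp: algebraic_tensor_def tensor_sum_def)
    then show "vnorm AT (vzero AT) \<le> 0" using tensor_norm_le[of "[]"] by (simp add: tensor_cost_def)
  qed (use nonneg \<open>vzero AT \<in> vcarrier AT\<close> in blast)
  show "0 \<le> vnorm AT u" if "u \<in> vcarrier AT" for u by (rule nonneg[OF that])
  show "vnorm AT (vscale AT c u) = norm c * vnorm AT u" if u: "u \<in> vcarrier AT" for u c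
  proof (cases "c = 0")
    case True
    then show ?thesis
      using tensor_norm_scale_le[OF u, of c] nonneg[OF tensor_scale_closed[OF u, of c]] by simp
  next
    case False
    \<comment> \<open>The reverse inequality is the one already shown, for \<open>inverse c\<close>
      and the vector \<open>vscale AT c u\<close>.\<close>
    have "vscale AT (inverse c) (vscale AT c u) = u"
      using False by (simp add: algebraic_tensor_def flip: mult.assoc)
    then have "norm c * vnorm AT u \<le> norm c * (norm (inverse c) * vnorm AT (vscale AT c u))"
      using tensor_norm_scale_le[OF tensor_scale_closed[OF u], of "inverse c" c]
      by (intro mult_left_mono) auto
    also have "\<dots> = vnorm AT (vscale AT c u)" using False by (simp add: norm_inverse)
    finally show ?thesis using tensor_norm_scale_le[OF u, of c] by simp
  qed
  show "vnorm AT (vadd AT u v) \<le> vnorm AT u + vnorm AT v" if uv: "u \<in> vcarrier AT" "v \<in> vcarrier AT" for u v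
  proof (rule field_le_epsilon)
    fix e :: real assume "0 < e"
    then have e: "0 < e / 2" by simp
    obtain ps where ps: "ps \<in> reps" "u = tensor_sum V W ps" "tensor_cost V W ps < vnorm AT u + e / 2"
      using tensor_norm_approx[OF uv(1) e] by metis
    obtain qs where qs: "qs \<in> reps" "v = tensor_sum V W qs" "tensor_cost V W qs < vnorm AT v + e / 2"
      using tensor_norm_approx[OF uv(2) e] by metis
    have "vadd AT u v = tensor_sum V W (ps @ qs)"
      unfolding ps(2) qs(2) tensor_sum_append by (simp add: algebraic_tensor_def)
    then have "vnorm AT (vadd AT u v) \<le> tensor_cost V W (ps @ qs)"
      using tensor_norm_le[of "ps @ qs"] ps(1) qs(1) by simp
    then show "vnorm AT (vadd AT u v) \<le> vnorm AT u + vnorm AT v + e"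
      using ps(3) qs(3) by (simp add: tensor_cost_append)
  qed
qed (auto simp: tensor_add_closed tensor_scale_closed, auto simp: algebraic_tensor_def fun_eq_iff algebra_simps)

text \<open>The easy half of the duality between the projective norm and bounded bilinear forms: the
  estimate holds for every representation of \<open>u\<close>, hence for the infimum. It supplies
  all lower bounds for the tensor norm.\<close>

lemma tensor_norm_dual:
  assumes u: "u \<in> vcarrier AT" and A: "bilinear_form V W A"
    and bound: "\<And>x y. x \<in> vcarrier V \<Longrightarrow> y \<in> vcarrier W \<Longrightarrow> norm (A x y) \<le> C * (vnorm V x * vnorm W y)"
    and C: "0 < C"
  shows "norm (u A) \<le> C * vnorm AT u"
proof -
  have "norm (tensor_sum V W ps A) \<le> C * tensor_cost V W ps" if "ps \<in> reps" for ps
    using that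
  proof (induction ps)
    case Nil
    show ?case by (simp add: tensor_sum_def tensor_cost_def)
  next
    case (Cons p ps)
    obtain x y where p: "p = (x, y)" by fastforce
    have "norm (A x y + tensor_sum V W ps A) \<le> norm (A x y) + norm (tensor_sum V W ps A)"
      by (rule norm_triangle_ineq)
    also have "\<dots> \<le> C * (vnorm V x * vnorm W y) + C * tensor_cost V W ps"
      using Cons bound[of x y] by (auto simp: p)
    finally show ?case using A by (simp add: p tensor_sum_def tensor_cost_def elem_tensor_def distrib_left)
  qed
  then have "norm (u A) / C \<le> vnorm AT u"
    using C by (intro tensor_norm_ge[OF u]) (auto simp: pos_divide_le_eq mult.commute)
  then show ?thesis using C by (simp add: pos_divide_le_eq mult.commute)
qed

end

section \<open>Rademacher functions\<close>

definition rad :: "'a set \<Rightarrow> 'a \<Rightarrow> real" where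
  "rad S i = (if i \<in> S then 1 else - 1)"

text \<open>For distinct \<open>i\<close> and \<open>j\<close>, moving \<open>i\<close> into or out
  of \<open>S\<close> is an involution that changes the sign of the product.\<close>

lemma rad_orthogonal:
  assumes "finite I" "i \<in> I" "j \<in> I"
  shows "(\<Sum>S\<in>Pow I. rad S i * rad S j) = (if i = j then 2 ^ card I else 0)"
proof (cases "i = j")
  case True
  have "rad S i * rad S i = 1" for S by (simp add: rad_def)
  then show ?thesis using True assms(1) by (simp add: card_Pow)
next
  case False
  define flip where "flip S = (if i \<in> S then S - {i} else insert i S)" for S
  have "(\<Sum>S\<in>Pow I. rad S i * rad S j) = (\<Sum>S\<in>Pow I. - (rad S i * rad S j))"
    by (rule sum.reindex_bij_witness[of _ flip flip])
      (use assms(2) False in \<open>auto simp: flip_def rad_def split: if_splits\<close>)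
  then show ?thesis using False by (simp add: sum_negf)
qed

text \<open>An elementary case of Khintchine's inequality: orthogonality gives the sum of the
  squares, and Cauchy--Schwarz passes to the sum of the norms. The inner product covers real and
  complex scalars alike.\<close>

lemma rad_sum_norm:
  fixes t :: "'a \<Rightarrow> 's::real_inner"
  assumes "finite I" "\<And>i. i \<in> I \<Longrightarrow> norm (t i) \<le> c"
  shows "(\<Sum>S\<in>Pow I. norm (\<Sum>i\<in>I. rad S i *\<^sub>R t i)) \<le> 2 ^ card I * sqrt (card I) * c"
proof (cases "I = {}")
  case False
  then have c: "0 \<le> c" using assms(2) norm_ge_zero order_trans by (metis all_not_in_conv)
  let ?a = "\<lambda>S. norm (\<Sum>i\<in>I. rad S i *\<^sub>R t i)"
  have "(\<Sum>S\<in>Pow I. (?a S)\<^sup>2) = (\<Sum>S\<in>Pow I. \<Sum>i\<in>I. \<Sum>j\<in>I. rad S i * rad S j * (t i \<bullet> t j))"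
    by (simp add: power2_norm_eq_inner inner_sum_left inner_sum_right sum_distrib_left inner_commute mult_ac)
  also have "\<dots> = (\<Sum>i\<in>I. \<Sum>j\<in>I. (\<Sum>S\<in>Pow I. rad S i * rad S j) * (t i \<bullet> t j))"
    by (subst sum.swap, rule sum.cong[OF refl], subst sum.swap) (simp add: sum_distrib_right)
  also have "\<dots> = (\<Sum>i\<in>I. \<Sum>j\<in>I. if i = j then 2 ^ card I * (t i \<bullet> t i) else 0)"
    using rad_orthogonal[OF assms(1)] by (intro sum.cong refl) auto
  also have "\<dots> = (\<Sum>i\<in>I. 2 ^ card I * (norm (t i))\<^sup>2)"
    using assms(1) by (simp add: power2_norm_eq_inner)
  also have "\<dots> \<le> (\<Sum>i\<in>I. 2 ^ card I * c\<^sup>2)"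
    using assms(2) by (intro sum_mono mult_left_mono power_mono) auto
  finally have "(\<Sum>S\<in>Pow I. (?a S)\<^sup>2) \<le> 2 ^ card I * (card I * c\<^sup>2)" by (simp add: mult_ac)
  then have "(\<Sum>S\<in>Pow I. ?a S)\<^sup>2 \<le> 2 ^ card I * (2 ^ card I * (card I * c\<^sup>2))"
    using sum_squared_le_sum_of_squares[of ?a "Pow I"] assms(1)
    by (simp add: card_Pow mult.commute) (meson mult_left_mono order_trans zero_le_numeral zero_le_power)
  also have "\<dots> = (2 ^ card I * sqrt (card I) * c)\<^sup>2"
    by (simp add: power_mult_distrib power2_eq_square)
  finally show ?thesis by (rule power2_le_imp_le) (use c in simp)
qed simp

section \<open>Function spaces and the contradiction with an embedding\<close>

lemma norm_scale_bcontfun [simp]: "norm (scale_bcontfun c f) = norm c * norm f"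
proof (rule antisym)
  have le: "norm (scale_bcontfun a h) \<le> norm a * norm h" for a and h :: "'a \<Rightarrow>\<^sub>C 'b"
    by (rule norm_bound) (simp add: norm_mult mult_left_mono norm_bounded)
  show "norm (scale_bcontfun c f) \<le> norm c * norm f" by (rule le)
  show "norm c * norm f \<le> norm (scale_bcontfun c f)"
  proof (cases "c = 0")
    case False
    have "f = scale_bcontfun (inverse c) (scale_bcontfun c f)"
      using False by (intro bcontfun_eqI) (simp flip: mult.assoc)
    then have "norm f \<le> norm (inverse c) * norm (scale_bcontfun c f)" by (metis le)
    then show ?thesis using False by (simp add: norm_divide field_simps)
  qed simp
qed

lemma scale_bcontfun_of_real: "scale_bcontfun (of_real r) f = r *\<^sub>R f"
  by (rule bcontfun_eqI) (simp add: scaleR_conv_of_real)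

text \<open>The carrier is left open to cover both \<open>c0_space\<close> and the full
  \<open>C_space\<close>.\<close>

lemma seminormed_C_space_restrict:
  fixes E :: "('x::topological_space \<Rightarrow>\<^sub>C 's::real_normed_field) set"
  assumes "0 \<in> E" "\<And>v w. v \<in> E \<Longrightarrow> w \<in> E \<Longrightarrow> v + w \<in> E" "\<And>c v. v \<in> E \<Longrightarrow> scale_bcontfun c v \<in> E"
  shows "seminormed (C_space TYPE('x) TYPE('s) \<lparr>vcarrier := E\<rparr>)"
  by unfold_locales
    (auto simp: C_space_def assms norm_triangle_ineq intro!: bcontfun_eqI simp: algebra_simps)

lemma seminormed_C_space: "seminormed (C_space TYPE('x::topological_space) TYPE('s::real_normed_field))"
  using seminormed_C_space_restrict[of "UNIV :: ('x \<Rightarrow>\<^sub>C 's) set"] by (simp add: C_space_def)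

text \<open>Both cases at once: \<open>E\<close> stands for the null sequences or for all of
  \<open>C(L)\<close>, of which \<open>signs\<close> captures what matters. In
  \<open>euclidean_space\<close>, bounded sequences of scalars have convergent subsequences and the
  Rademacher estimate is available.\<close>

lemma not_embeds_in_quotient:
  fixes E :: "('x::topological_space \<Rightarrow>\<^sub>C 's::{real_normed_field, euclidean_space}) set"
  assumes K: "compact (UNIV :: 'k::t2_space set)" "scattered (UNIV :: 'k set)"
    and X: "infinite (UNIV :: 'x set)"
    and E: "0 \<in> E" "\<And>v w. v \<in> E \<Longrightarrow> w \<in> E \<Longrightarrow> v + w \<in> E" "\<And>c v. v \<in> E \<Longrightarrow> scale_bcontfun c v \<in> E"
    and signs: "\<And>P N :: 'x set. finite P \<Longrightarrow> finite N \<Longrightarrow> P \<inter> N = {} \<Longrightarrow>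
      \<exists>v\<in>E. norm v \<le> 1 \<and> (\<forall>x\<in>P. apply_bcontfun v x = 1) \<and> (\<forall>x\<in>N. apply_bcontfun v x = - 1)"
  shows "\<not> embeds_in_quotient
    (C_space TYPE('x) TYPE('s) \<lparr>vcarrier := E\<rparr> \<otimes>\<^sub>\<pi> C_space TYPE('k) TYPE('s)) (C_space TYPE('k) TYPE('s))"
proof
  define V where "V = C_space TYPE('x) TYPE('s) \<lparr>vcarrier := E\<rparr>"
  define W where "W = C_space TYPE('k) TYPE('s)"
  assume "embeds_in_quotient (C_space TYPE('x) TYPE('s) \<lparr>vcarrier := E\<rparr> \<otimes>\<^sub>\<pi> C_space TYPE('k) TYPE('s))
    (C_space TYPE('k) TYPE('s))"
  then have emb: "embeds_in_quotient (Banach_completion (algebraic_tensor V W)) W"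
    by (simp add: projective_tensor_def V_def W_def)
  interpret V: seminormed V unfolding V_def by (rule seminormed_C_space_restrict[OF E])
  interpret W: seminormed W unfolding W_def by (rule seminormed_C_space)
  interpret tensor_factors V W ..
  have V_simps: "vcarrier V = E" "vadd V = (+)" "vscale V = scale_bcontfun" "vnorm V = norm"
    and W_simps: "vcarrier W = UNIV" "vadd W = (+)" "vscale W = scale_bcontfun" "vnorm W = norm"
    by (simp_all add: V_def W_def C_space_def)
  obtain R :: "_ \<Rightarrow> ('k \<Rightarrow>\<^sub>C 's) \<Rightarrow> bool" and B c where B: "0 \<le> B" and c: "0 \<le> c"
    and R_add: "\<And>u g u' g'. R u g \<Longrightarrow> R u' g' \<Longrightarrow> R (vadd AT u u') (g + g')"
    and R_scale: "\<And>a u g. R u g \<Longrightarrow> R (vscale AT a u) (scale_bcontfun a g)"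
    and R_lift: "\<And>u. u \<in> vcarrier AT \<Longrightarrow> \<exists>g. R u g \<and> norm g \<le> B * vnorm AT u + 1"
    and R_norm: "\<And>u g. R u g \<Longrightarrow> vnorm AT u \<le> c * norm g"
    using embeds_in_quotient_relation[OF seminormed_tensor W.seminormed_axioms emb, unfolded W_simps] by metis
  let ?t = "tensor_sum V W"
  have add: "vadd AT u w = (\<lambda>A. u A + w A)" and scale: "vscale AT a u = (\<lambda>A. a * u A)" for u w a
    by (simp_all add: algebraic_tensor_def)
  have t_add: "vadd AT (?t [(v, f)]) (?t [(v, f')]) = ?t [(v, f + f')]" if "v \<in> E" for v f f'
    using that by (auto simp: add tensor_sum_def elem_tensor_def bilinear_form_def V_simps W_simps)
  have t_scale: "vscale AT a (?t [(v, f)]) = ?t [(v, scale_bcontfun a f)]" if "v \<in> E" for v f a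
    using that by (auto simp: scale tensor_sum_def elem_tensor_def bilinear_form_def V_simps W_simps)
  have carrier: "?t ps \<in> vcarrier AT" if "fst ` set ps \<subseteq> E" for ps
    unfolding tensor_carrier using that by (force simp: V_simps W_simps)
  have R_tensor: "\<exists>g. R (?t [(v, f)]) g \<and> norm g \<le> B + 1"
    if v: "v \<in> E" "norm v \<le> 1" and f: "norm f \<le> 1" for v f
  proof -
    have "vnorm AT (?t [(v, f)]) \<le> norm v * norm f"
      using tensor_norm_le[of "[(v, f)]"] v(1) by (simp add: tensor_cost_def V_simps W_simps)
    also have "\<dots> \<le> 1" using v(2) f by (simp add: mult_le_one)
    finally have "B * vnorm AT (?t [(v, f)]) + 1 \<le> B + 1" using B mult_left_le by fastforce
    then show ?thesis using R_lift[OF carrier, of "[(v, f)]"] v(1) by fastforce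
  qed
  show False
  proof (cases "finite (UNIV :: 'k set)")
    case True
    obtain l :: "nat \<Rightarrow> 'x" where l: "inj l"
      using infinite_countable_subset[OF X] by blast
    \<comment> \<open>This pattern of signs separates the \<open>v k\<close>: for
      \<open>i < j\<close>, the difference of \<open>v j\<close> and \<open>v i\<close> is 2 at
      \<open>l i\<close>.\<close>
    have "\<exists>v\<in>E. norm v \<le> 1 \<and> (\<forall>x\<in>l ` {..<k}. apply_bcontfun v x = 1) \<and> (\<forall>x\<in>{l k}. apply_bcontfun v x = - 1)" for k
      by (rule signs) (use l in \<open>auto simp: inj_eq\<close>)
    then obtain v where "\<forall>k. v k \<in> E \<and> norm (v k) \<le> 1 \<and> (\<forall>x\<in>l ` {..<k}. apply_bcontfun (v k) x = 1) \<and>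
        (\<forall>x\<in>{l k}. apply_bcontfun (v k) x = - 1)"
      unfolding Bex_def by (metis (no_types))
    then have v: "\<And>k. v k \<in> E" "\<And>k. norm (v k) \<le> 1" "\<And>j k. j < k \<Longrightarrow> apply_bcontfun (v k) (l j) = 1"
        "\<And>k. apply_bcontfun (v k) (l k) = - 1"
      by auto
    obtain g where g: "\<And>k. R (?t [(v k, const_bcontfun 1)]) (g k)" "\<And>k. norm (g k) \<le> B + 1"
    proof -
      have "norm (const_bcontfun 1 :: 'k \<Rightarrow>\<^sub>C 's) \<le> 1" by (rule norm_bound) simp
      then show thesis using R_tensor[OF v(1,2)] that by metis
    qed
    have "bounded (range (\<lambda>k. apply_bcontfun (g k) x))" for x
      unfolding bounded_iff using g(2) norm_bounded order_trans by blast
    \<comment> \<open>With this distance between two lifts, the tensor norm of the difference is at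
      most 1, against the lower bound 2.\<close>
    moreover have e: "0 < 1 / (c + 1)" using c by simp
    ultimately obtain i j where ij: "i < j" "\<And>x. dist (apply_bcontfun (g i) x) (apply_bcontfun (g j) x) < 1 / (c + 1)"
      using finite_pigeonhole[OF True _ e, of "\<lambda>k. apply_bcontfun (g k)"] by auto
    define u where "u = vadd AT (?t [(v j, const_bcontfun 1)]) (vscale AT (- 1) (?t [(v i, const_bcontfun 1)]))"
    have u: "u \<in> vcarrier AT"
      unfolding u_def by (intro tensor_add_closed tensor_scale_closed carrier) (auto simp: v)
    \<comment> \<open>Evaluation at \<open>l i\<close> in the first factor and at an arbitrary point
      of \<open>K\<close>, here \<open>undefined\<close>, in the second.\<close>
    define A :: "('x \<Rightarrow>\<^sub>C 's) \<Rightarrow> ('k \<Rightarrow>\<^sub>C 's) \<Rightarrow> 's" where "A w f = apply_bcontfun w (l i) * apply_bcontfun f undefined" for w f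
    have A: "bilinear_form V W A"
      by (simp add: bilinear_form_def A_def V_simps W_simps algebra_simps)
    have "norm (u A) \<le> 1 * vnorm AT u"
    proof (rule tensor_norm_dual[OF u A])
      show "norm (A w f) \<le> 1 * (vnorm V w * vnorm W f)" for w f
        by (simp add: A_def V_simps W_simps norm_mult mult_mono norm_bounded)
    qed simp
    moreover have "u A = 2"
      using A v(3)[OF ij(1)] v(4)[of i]
      by (simp add: u_def add scale tensor_sum_def elem_tensor_def A_def const_bcontfun.rep_eq)
    ultimately have "2 \<le> vnorm AT u" by simp
    also have "\<dots> \<le> c * norm (g j + scale_bcontfun (- 1) (g i))"
      unfolding u_def by (intro R_norm R_add R_scale g)
    also have "\<dots> \<le> c * (1 / (c + 1))"
    proof (intro mult_left_mono norm_bound c)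
      fix x
      have "norm (apply_bcontfun (g j) x - apply_bcontfun (g i) x) < 1 / (c + 1)" using ij(2)[of x] by (simp add: dist_norm norm_minus_commute)
      then show "norm (apply_bcontfun (g j + scale_bcontfun (- 1) (g i)) x) \<le> 1 / (c + 1)" by simp
    qed
    also have "\<dots> \<le> 1" using c by simp
    finally show False by simp
  next
    case False
    obtain C where C: "\<And>n (R :: nat \<Rightarrow> ('k \<Rightarrow>\<^sub>C 's) \<Rightarrow> ('k \<Rightarrow>\<^sub>C 's) \<Rightarrow> bool).
        (\<And>i. liftable (B + 1) (R i)) \<Longrightarrow>
        \<exists>f g x. (\<forall>i<n. R i (f i) (g i) \<and> apply_bcontfun (f i) (x i) = 1) \<and> norm (\<Sum>i<n. g i) \<le> C"
      using scattered_bounded_sums[OF K False, where ?'s = 's and B = "B + 1"] by metis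
    \<comment> \<open>Chosen to contradict \<open>sqrt n \<le> c * C\<close>, the outcome of the two
      estimates of the tensor norm of \<open>u\<close>.\<close>
    obtain n :: nat where n: "(c * C)\<^sup>2 < real n" using reals_Archimedean2 by blast
    then have n0: "0 < n" by (metis not_gr_zero of_nat_0 not_less zero_le_power2)
    let ?P = "Pow {..<n}"
    obtain l :: "nat set \<Rightarrow> 'x" where l: "inj_on l ?P"
    proof -
      obtain D :: "'x set" where "finite D" "card D = card ?P"
        using infinite_arbitrarily_large[OF X] by blast
      then show thesis using finite_same_card_bij[of ?P D] that bij_betw_imp_inj_on by auto
    qed
    \<comment> \<open>With the points \<open>l S\<close> labelled by the subsets \<open>S\<close> of
      \<open>{..<n}\<close>, the function \<open>v i\<close> restricts to the \<open>i\<close>-th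
      Rademacher function.\<close>
    have "\<forall>i. \<exists>v. v \<in> E \<and> norm v \<le> 1 \<and> (\<forall>x\<in>l ` {S \<in> ?P. i \<in> S}. apply_bcontfun v x = 1) \<and>
        (\<forall>x\<in>l ` {S \<in> ?P. i \<notin> S}. apply_bcontfun v x = - 1)"
      by (rule allI, rule signs[unfolded Bex_def]) (use l in \<open>auto simp: inj_on_def\<close>)
    from choice[OF this] obtain v where "\<forall>i. v i \<in> E \<and> norm (v i) \<le> 1 \<and>
        (\<forall>x\<in>l ` {S \<in> ?P. i \<in> S}. apply_bcontfun (v i) x = 1) \<and>
        (\<forall>x\<in>l ` {S \<in> ?P. i \<notin> S}. apply_bcontfun (v i) x = - 1)" ..
    then have v: "\<And>i. v i \<in> E" "\<And>i. norm (v i) \<le> 1"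
        "\<And>i S. S \<in> ?P \<Longrightarrow> i \<in> S \<Longrightarrow> apply_bcontfun (v i) (l S) = 1"
        "\<And>i S. S \<in> ?P \<Longrightarrow> i \<notin> S \<Longrightarrow> apply_bcontfun (v i) (l S) = - 1"
      by auto
    have v_rad: "apply_bcontfun (v i) (l S) = of_real (rad S i)" if "S \<in> ?P" for i S
      using v(3,4)[OF that] by (simp add: rad_def)
    have lift: "liftable (B + 1) (\<lambda>f. R (?t [(v i, f)]))" for i
      unfolding liftable_def
    proof (intro conjI allI impI)
      show "R (?t [(v i, f + f')]) (g + g')" if "R (?t [(v i, f)]) g" "R (?t [(v i, f')]) g'" for f g f' g'
        using R_add[OF that] t_add[OF v(1)] by simp
      show "R (?t [(v i, a *\<^sub>R f)]) (a *\<^sub>R g)" if "R (?t [(v i, f)]) g" for a f g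
        using R_scale[OF that, of "of_real a"] t_scale[OF v(1)] by (simp add: scale_bcontfun_of_real)
    qed (rule R_tensor[OF v(1,2)])
    obtain f g x where fg: "\<And>i. i < n \<Longrightarrow> R (?t [(v i, f i)]) (g i)"
        "\<And>i. i < n \<Longrightarrow> apply_bcontfun (f i) (x i) = 1" "norm (\<Sum>i<n. g i) \<le> C"
      using C[of "\<lambda>i f. R (?t [(v i, f)])" n, OF lift] by blast
    define u where "u = ?t (map (\<lambda>i. (v i, f i)) [0..<n])"
    have u: "u \<in> vcarrier AT" unfolding u_def by (rule carrier) (auto simp: v)
    have "R (?t (map (\<lambda>i. (v i, f i)) [0..<r])) (\<Sum>i<r. g i)" if "r \<le> n" for r
      using that
    proof (induction r)
      case 0
      \<comment> \<open>The empty sum is related to 0 by scaling a related pair by 0;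
        \<open>n0\<close> makes the pair of index 0 available.\<close>
      have "vscale AT 0 (?t [(v 0, f 0)]) = ?t []" by (simp add: scale tensor_sum_def fun_eq_iff)
      moreover have "scale_bcontfun 0 (g 0) = 0" by (rule bcontfun_eqI) simp
      ultimately show ?case using R_scale[OF fg(1)[OF n0], of 0] by simp
    next
      case (Suc r)
      have "R (vadd AT (?t (map (\<lambda>i. (v i, f i)) [0..<r])) (?t [(v r, f r)])) ((\<Sum>i<r. g i) + g r)"
        using Suc by (intro R_add fg) auto
      then show ?case by (simp add: add tensor_sum_append)
    qed
    then have "R u (\<Sum>i<n. g i)" unfolding u_def by simp
    then have "vnorm AT u \<le> c * norm (\<Sum>i<n. g i)" by (rule R_norm)
    also have "\<dots> \<le> c * C" using fg(3) c by (rule mult_left_mono)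
    finally have upper: "vnorm AT u \<le> c * C" .
    \<comment> \<open>The averaging factor \<open>1 / 2 ^ n\<close> is omitted here, so
      \<open>2 ^ n\<close> appears in the bound and in the value at \<open>u\<close>.\<close>
    define A :: "('x \<Rightarrow>\<^sub>C 's) \<Rightarrow> ('k \<Rightarrow>\<^sub>C 's) \<Rightarrow> 's" where
      "A w h = (\<Sum>S\<in>?P. apply_bcontfun w (l S) * (\<Sum>i<n. rad S i *\<^sub>R apply_bcontfun h (x i)))" for w h
    have A: "bilinear_form V W A"
      by (simp add: bilinear_form_def A_def V_simps W_simps algebra_simps sum.distrib sum_distrib_left
          scaleR_conv_of_real)
    have "norm (u A) \<le> (2 ^ n * sqrt n) * vnorm AT u"
    proof (rule tensor_norm_dual[OF u A])
      show "norm (A w h) \<le> (2 ^ n * sqrt n) * (vnorm V w * vnorm W h)" for w h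
      proof -
        have "norm (A w h) \<le> (\<Sum>S\<in>?P. norm w * norm (\<Sum>i<n. rad S i *\<^sub>R apply_bcontfun h (x i)))"
          unfolding A_def by (intro sum_norm_le) (simp add: norm_mult mult_right_mono norm_bounded)
        also have "\<dots> = norm w * (\<Sum>S\<in>?P. norm (\<Sum>i<n. rad S i *\<^sub>R apply_bcontfun h (x i)))"
          by (simp add: sum_distrib_left)
        also have "\<dots> \<le> norm w * (2 ^ card {..<n} * sqrt (card {..<n}) * norm h)"
          by (intro mult_left_mono rad_sum_norm) (auto simp: norm_bounded)
        finally show ?thesis by (simp add: V_simps W_simps mult_ac)
      qed
    qed (use n0 in simp)
    \<comment> \<open>Nothing is known about \<open>f i\<close> at \<open>x j\<close> for distinct
      \<open>i\<close> and \<open>j\<close>, but orthogonality removes these terms and leaves the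
      values 1 at \<open>x i\<close>.\<close>
    moreover have "u A = of_nat (n * 2 ^ n)"
    proof -
      have "u A = (\<Sum>i<n. A (v i) (f i))"
        unfolding u_def tensor_sum_def elem_tensor_def using A
        by (simp add: o_def interv_sum_list_conv_sum_set_nat atLeast0LessThan)
      also have "\<dots> = (\<Sum>i<n. \<Sum>S\<in>?P. \<Sum>j<n. (rad S i * rad S j) *\<^sub>R apply_bcontfun (f i) (x j))"
        unfolding A_def by (intro sum.cong refl) (simp add: v_rad scaleR_conv_of_real sum_distrib_left mult_ac)
      also have "\<dots> = (\<Sum>i<n. \<Sum>j<n. (\<Sum>S\<in>?P. rad S i * rad S j) *\<^sub>R apply_bcontfun (f i) (x j))"
        by (rule sum.cong[OF refl], subst sum.swap) (simp add: scaleR_sum_left)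
      also have "\<dots> = (\<Sum>i<n. \<Sum>j<n. if i = j then (2 ^ n :: real) *\<^sub>R apply_bcontfun (f i) (x i) else 0)"
        using rad_orthogonal[of "{..<n}"] by (intro sum.cong refl) simp
      also have "\<dots> = (\<Sum>i<n. (2 ^ n :: real) *\<^sub>R 1)" using fg(2) by simp
      finally show ?thesis by (simp add: scaleR_conv_of_real)
    qed
    ultimately have "real (n * 2 ^ n) \<le> (2 ^ n * sqrt n) * vnorm AT u" by (simp only: norm_of_nat)
    then have "sqrt n * sqrt n \<le> sqrt n * vnorm AT u" by (simp add: mult_ac)
    then have "sqrt n \<le> vnorm AT u" using n0 by (simp only: mult_le_cancel_left_pos real_sqrt_gt_0_iff of_nat_0_less_iff)
    then have "sqrt n \<le> c * C" using upper by simp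
    then have "real n \<le> (c * C)\<^sup>2" by (metis real_sqrt_le_iff real_sqrt_le_iff sqrt_le_D)
    then show False using n by simp
  qed
qed

section \<open>Prescribed signs in \<open>c0_space\<close> and \<open>C_space\<close>\<close>

lemma finite_sign_sequence:
  fixes P N :: "nat set"
  assumes "finite P" "finite N" "P \<inter> N = {}"
  shows "\<exists>v :: nat \<Rightarrow>\<^sub>C 's::real_normed_algebra_1. apply_bcontfun v \<longlonglongrightarrow> 0 \<and> norm v \<le> 1 \<and>
    (\<forall>x\<in>P. apply_bcontfun v x = 1) \<and> (\<forall>x\<in>N. apply_bcontfun v x = - 1)"
proof -
  define u :: "nat \<Rightarrow> real" where "u k = (if k \<in> P then 1 else if k \<in> N then - 1 else 0)" for k
  obtain v :: "nat \<Rightarrow>\<^sub>C 's" where v: "\<And>k. v k = of_real (u k)" "norm v \<le> 1"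
  proof -
    have "\<bar>u k\<bar> \<le> 1" for k by (simp add: u_def)
    then show thesis using bcontfun_of_real[of u] that by auto
  qed
  have "\<forall>\<^sub>F k in sequentially. k \<notin> P \<union> N"
    using assms(1,2) by (simp add: eventually_cofinite flip: cofinite_eq_sequentially)
  then have "\<forall>\<^sub>F k in sequentially. v k = 0" by eventually_elim (simp add: v u_def)
  then have "apply_bcontfun v \<longlonglongrightarrow> 0" by (rule tendsto_eventually)
  then show ?thesis using v assms(3) by (intro exI[of _ v]) (auto simp: u_def)
qed

text \<open>A Urysohn function \<open>u\<close> for the finite, hence closed, sets \<open>N\<close>
  and \<open>P\<close> is rescaled to \<open>2 * u x - 1\<close>.\<close>

lemma finite_sign_function:
  fixes P N :: "'l::t2_space set"
  assumes "compact (UNIV :: 'l set)" "finite P" "finite N" "P \<inter> N = {}"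
  shows "\<exists>v :: 'l \<Rightarrow>\<^sub>C 's::real_normed_algebra_1. norm v \<le> 1 \<and>
    (\<forall>x\<in>P. apply_bcontfun v x = 1) \<and> (\<forall>x\<in>N. apply_bcontfun v x = - 1)"
proof -
  obtain u :: "'l \<Rightarrow> real" where u: "continuous_on UNIV u" "\<And>x. 0 \<le> u x" "\<And>x. u x \<le> 1"
      "\<And>x. x \<in> N \<Longrightarrow> u x = 0" "\<And>x. x \<in> P \<Longrightarrow> u x = 1"
    using compact_Urysohn[OF assms(1) finite_imp_closed[OF assms(3)] finite_imp_closed[OF assms(2)]] assms(4)
    by (metis Int_commute)
  have "\<bar>2 * u x - 1\<bar> \<le> 1" for x using u(2,3)[of x] by (simp add: abs_le_iff)
  moreover have "continuous_on UNIV (\<lambda>x. 2 * u x - 1)" by (intro continuous_intros u(1))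
  ultimately obtain v :: "'l \<Rightarrow>\<^sub>C 's" where "\<And>x. v x = of_real (2 * u x - 1)" "norm v \<le> 1"
    using bcontfun_of_real[of "\<lambda>x. 2 * u x - 1"] by metis
  then show ?thesis using u(4,5) by (intro exI[of _ v]) auto
qed

lemma c0_not_embeds_in_quotient:
  assumes "compact (UNIV :: 'k::t2_space set)" "scattered (UNIV :: 'k set)"
  shows "\<not> embeds_in_quotient
    (c0_space TYPE('s::{real_normed_field, euclidean_space}) \<otimes>\<^sub>\<pi> C_space TYPE('k) TYPE('s))
    (C_space TYPE('k) TYPE('s))"
  unfolding c0_space_def
proof (rule not_embeds_in_quotient[OF assms])
  show "v + w \<in> {f. apply_bcontfun f \<longlonglongrightarrow> 0}"
    if "v \<in> {f. apply_bcontfun f \<longlonglongrightarrow> 0}" "w \<in> {f. apply_bcontfun f \<longlonglongrightarrow> 0}" for v w :: "nat \<Rightarrow>\<^sub>C 's"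
    using tendsto_add[of "apply_bcontfun v" 0 _ "apply_bcontfun w" 0] that
    by (simp add: plus_bcontfun.rep_eq)
  show "scale_bcontfun c v \<in> {f. apply_bcontfun f \<longlonglongrightarrow> 0}"
    if "v \<in> {f. apply_bcontfun f \<longlonglongrightarrow> 0}" for c and v :: "nat \<Rightarrow>\<^sub>C 's"
  proof -
    have "apply_bcontfun (scale_bcontfun c v) = (\<lambda>k. c * apply_bcontfun v k)" by (rule ext) simp
    then show ?thesis using tendsto_mult_left[of "apply_bcontfun v" 0 _ c] that by simp
  qed
qed (use finite_sign_sequence in \<open>auto simp: zero_bcontfun.rep_eq\<close>)

lemma C_space_not_embeds_in_quotient:
  assumes "compact (UNIV :: 'k::t2_space set)" "scattered (UNIV :: 'k set)"
    and "compact (UNIV :: 'l::t2_space set)" "infinite (UNIV :: 'l set)"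
  shows "\<not> embeds_in_quotient
    (C_space TYPE('l) TYPE('s::{real_normed_field, euclidean_space}) \<otimes>\<^sub>\<pi> C_space TYPE('k) TYPE('s))
    (C_space TYPE('k) TYPE('s))"
proof -
  have "C_space TYPE('l) TYPE('s) = C_space TYPE('l) TYPE('s) \<lparr>vcarrier := UNIV\<rparr>"
    by (simp add: C_space_def)
  moreover have "\<not> embeds_in_quotient
      (C_space TYPE('l) TYPE('s) \<lparr>vcarrier := UNIV\<rparr> \<otimes>\<^sub>\<pi> C_space TYPE('k) TYPE('s)) (C_space TYPE('k) TYPE('s))"
    by (rule not_embeds_in_quotient[OF assms(1,2,4)]) (use finite_sign_function[OF assms(3)] in auto)
  ultimately show ?thesis by simp
qed

theorem corollary7p5:
  assumes "compact (UNIV :: 'k::t2_space set)"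
    and "compact (UNIV :: 'l::t2_space set)"
    and "infinite (UNIV :: 'l set)"
    and "scattered (UNIV :: 'k set)"
  shows "(\<not> embeds_in_quotient
            (c0_space TYPE(real) \<otimes>\<^sub>\<pi> C_space TYPE('k) TYPE(real))
            (C_space TYPE('k) TYPE(real)) \<and>
          \<not> embeds_in_quotient
            (C_space TYPE('l) TYPE(real) \<otimes>\<^sub>\<pi> C_space TYPE('k) TYPE(real))
            (C_space TYPE('k) TYPE(real))) \<and>
         (\<not> embeds_in_quotient
            (c0_space TYPE(complex) \<otimes>\<^sub>\<pi> C_space TYPE('k) TYPE(complex))
            (C_space TYPE('k) TYPE(complex)) \<and>
          \<not> embeds_in_quotient
            (C_space TYPE('l) TYPE(complex) \<otimes>\<^sub>\<pi> C_space TYPE('k) TYPE(complex))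
            (C_space TYPE('k) TYPE(complex)))"
  using assms by (intro conjI c0_not_embeds_in_quotient C_space_not_embeds_in_quotient)

end
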